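(* Let $P=\{p_1,\dots,p_s\}$ be a finite set of primes, let $m\in\mathbb{N}_P$, let $a\in\mathbb{Z}$ with $\gcd(a,m)=1$, let $b\ge 2$ be an integer with $\gcd(m,b)=1$, and let $k\ge 0$ be an integer. Then for every integer $N\ge 1$, \[ \left|\sum_{n=1}^N e\!\left(\frac{a}{m}b^n\right)\right| \le K_1\, K_2^k\, m^{\frac{1}{2^{k+2}-2}} N^{1-\frac{k+3+c_k}{2^{k+2}}}(1+\log m)^{2^{-k}} + K_3\, m^{-\frac{1}{2^{k+2}-2}} N^{1+\frac{k-1+c_k}{2^{k+2}}}(1+\log m)^{2^{-k}}, \] where \[ K_1 = 6\cdot 2^{s+7/2} Q^{3/2} b^{4Q}\prod_{i=1}^s \frac{p_i^{1/2}}{(p_i^{1/2}-1)(1-p_i^{-1})},\quad K_2=2^s,\quad K_3 = 2^{3/2}Q^{1/2}b^{2Q}\prod_{i=1}^s\frac{p_i^{1/2}}{p_i^{1/2}-1}, \] $Q=p_1p_2\cdots p_s$, and $c_k$ is a real number depending only on $k$ satisfying $|c_k-c|\le \frac{k+7}{2^{k-1}}$, where $c$ is the absolute constant \[ c=\sum_{j=0}^\infty\left(\left(1+\frac{1}{2^{j+1}-1}\right)\prod_{i=j}^\infty\left(1-\frac{2}{2^{i+2}-1}\right)-1\right)\approx -1.17094960687. \]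
   Context: $e(z)=e^{2\pi i z}$. For a finite set of primes $P$, $\mathbb{N}_P$ denotes the set of positive integers all of whose prime factors lie in $P$ (with $1\in\mathbb{N}_P$). $\log$ is the natural logarithm. *)

theory Defs
  imports
    "HOL-Analysis.Analysis"
    "HOL-Computational_Algebra.Primes"
begin

definition e2pi :: "complex \<Rightarrow> complex"
  where "e2pi z = exp (2 * of_real pi * \<i> * z)"

text \<open>\<open>\<nat>\<^sub>P\<close>, the positive integers all of whose prime factors lie in \<open>P\<close>.\<close>
definition nats_over :: "nat set \<Rightarrow> nat set"
  where "nats_over P = {n. n > 0 \<and> prime_factors n \<subseteq> P}"

definition K1 :: "nat set \<Rightarrow> int \<Rightarrow> real" where
  "K1 P b = 6 * 2 powr (real (card P) + 7/2) * real (\<Prod>P) powr (3/2) * of_int b ^ (4 * \<Prod>P)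
     * (\<Prod>p\<in>P. real p powr (1/2) / ((real p powr (1/2) - 1) * (1 - 1 / real p)))"

definition K2 :: "nat set \<Rightarrow> real" where
  "K2 P = 2 ^ card P"

definition K3 :: "nat set \<Rightarrow> int \<Rightarrow> real" where
  "K3 P b = 2 powr (3/2) * real (\<Prod>P) powr (1/2) * of_int b ^ (2 * \<Prod>P)
     * (\<Prod>p\<in>P. real p powr (1/2) / (real p powr (1/2) - 1))"

definition c_factor :: "nat \<Rightarrow> real" where
  "c_factor i = 1 - 2 / (2 ^ (i + 2) - 1)"

text \<open>The infinite product \<open>\<Prod>\<^sub>i\<^sub>\<ge>\<^sub>j\<close> is written with its index shifted by \<open>j\<close>.\<close>
definition c_term :: "nat \<Rightarrow> real" where
  "c_term j = (1 + 1 / (2 ^ (j + 1) - 1)) * (\<Prod>i. c_factor (i + j)) - 1"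

definition c_const :: real where
  "c_const = (\<Sum>j. c_term j)"

text \<open>The product and the series converge, so \<open>prodinf\<close> and \<open>suminf\<close> above take their
  intended values.\<close>

lemma two_power_bound: "(2::real) / (2 ^ (i + 2) - 1) \<le> (1/2) ^ i"
proof -
  have "(1::real) \<le> 2 ^ i" by simp
  then have "(1::real) \<le> 2 * 2 ^ i" "0 < 4 * (2::real) ^ i - 1" by linarith+
  then show ?thesis by (simp add: field_simps)
qed

lemma two_power_pos: "(0::real) < 2 / (2 ^ (i + 2) - 1)"
proof -
  have "(1::real) \<le> 2 ^ i" by simp
  then have "0 < 4 * (2::real) ^ i - 1" by linarith
  then show ?thesis by simp
qed

lemma c_factor_bounds: "0 < c_factor i" "c_factor i < 1"
proof -
  have "(1::real) \<le> 2 ^ i" by simp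
  then have "2 < 4 * (2::real) ^ i - 1" by linarith
  then have "2 / (4 * (2::real) ^ i - 1) < 1" by (subst divide_less_eq_1_pos) linarith+
  then show "0 < c_factor i" by (simp add: c_factor_def)
  show "c_factor i < 1" using two_power_pos[of i] by (simp add: c_factor_def)
qed

lemma convergent_prod_c_factor: "convergent_prod (\<lambda>i. c_factor (i + j))"
proof -
  have "summable (\<lambda>i. (2::real) / (2 ^ (i + 2) - 1))"
  proof (rule summable_comparison_test)
    have "norm ((2::real) / (2 ^ (i + 2) - 1)) \<le> (1/2) ^ i" for i
      using two_power_bound[of i] two_power_pos[of i] unfolding real_norm_def by linarith
    then show "\<exists>N. \<forall>n\<ge>N. norm ((2::real) / (2 ^ (n + 2) - 1)) \<le> (1/2) ^ n" by blast
  qed (rule summable_geometric, simp)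
  then have "summable (\<lambda>i. (2::real) / (2 ^ (i + j + 2) - 1))"
    by (rule summable_ignore_initial_segment)
  moreover have "\<bar>- ((2::real) / (2 ^ (i + j + 2) - 1))\<bar> = 2 / (2 ^ (i + j + 2) - 1)" for i
    using two_power_pos[of "i + j"] by linarith
  ultimately have "summable (\<lambda>i. \<bar>- ((2::real) / (2 ^ (i + j + 2) - 1))\<bar>)"
    by presburger
  then have "convergent_prod (\<lambda>i. 1 + - ((2::real) / (2 ^ (i + j + 2) - 1)))"
  proof (rule summable_imp_convergent_prod_real)
    show "- ((2::real) / (2 ^ (i + j + 2) - 1)) \<noteq> - 1" for i
      using c_factor_bounds(1)[of "i + j"] unfolding c_factor_def by linarith
  qed
  then show ?thesis by (simp add: c_factor_def)
qed

lemma prodinf_c_factor_bounds: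
  "1 - 2 * (1/2) ^ j \<le> (\<Prod>i. c_factor (i + j))" "(\<Prod>i. c_factor (i + j)) \<le> 1"
proof -
  have lim: "(\<lambda>n. \<Prod>i\<le>n. c_factor (i + j)) \<longlonglongrightarrow> (\<Prod>i. c_factor (i + j))"
    by (rule convergent_prod_LIMSEQ[OF convergent_prod_c_factor])
  have low: "1 - 2 * (1/2) ^ j + 2 * (1/2) ^ (n + j) \<le> (\<Prod>i<n. c_factor (i + j))" for n
  proof (induction n)
    case (Suc n)
    let ?p = "\<Prod>i<n. c_factor (i + j)"
    have p: "0 \<le> ?p" "?p \<le> 1"
      by (auto intro!: prod_nonneg prod_le_1 less_imp_le[OF c_factor_bounds(1)]
          less_imp_le[OF c_factor_bounds(2)])
    have "?p - (\<Prod>i<Suc n. c_factor (i + j)) = ?p * (2 / (2 ^ (n + j + 2) - 1))"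
      by (simp add: c_factor_def right_diff_distrib)
    also have "\<dots> \<le> 1 * (1/2) ^ (n + j)"
      by (rule mult_mono) (use p two_power_bound[of "n + j"] less_imp_le[OF two_power_pos[of "n + j"]] in auto)
    finally have "?p - (\<Prod>i<Suc n. c_factor (i + j)) \<le> (1/2) ^ (n + j)" by simp
    then show ?case using Suc by simp
  qed simp
  have "1 - 2 * (1/2) ^ j \<le> (\<Prod>i\<le>n. c_factor (i + j))" for n
  proof -
    have "(0::real) \<le> 2 * (1/2) ^ (Suc n + j)" by simp
    then show ?thesis using low[of "Suc n"] unfolding lessThan_Suc_atMost by linarith
  qed
  then show "1 - 2 * (1/2) ^ j \<le> (\<Prod>i. c_factor (i + j))"
    by (intro LIMSEQ_le_const[OF lim]) blast
  have "(\<Prod>i\<le>n. c_factor (i + j)) \<le> 1" for n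
    using c_factor_bounds by (intro prod_le_1) (auto intro: less_imp_le)
  then show "(\<Prod>i. c_factor (i + j)) \<le> 1"
    by (intro LIMSEQ_le_const2[OF lim]) blast
qed

lemma summable_c_term: "summable c_term"
proof (rule summable_comparison_test)
  have "norm (c_term j) \<le> 2 * (1/2) ^ j" for j
  proof -
    let ?p = "\<Prod>i. c_factor (i + j)" and ?q = "1 / (2 ^ (j + 1) - 1) :: real"
    have one: "(1::real) \<le> 2 ^ j" by simp
    have pos: "0 < (2::real) ^ (j + 1) - 1" using one by (simp only: power_add power_one_right)
    have "?q \<le> 1 / 2 ^ j"
      by (rule divide_left_mono) (use one pos in \<open>simp_all add: mult_pos_pos\<close>)
    then have q: "0 \<le> ?q" "?q \<le> (1/2) ^ j"
      using less_imp_le[OF pos] by (simp_all only: power_one_over zero_le_divide_1_iff)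
    have "?q * ?p \<le> ?q * 1" using prodinf_c_factor_bounds(2)[of j] q by (intro mult_left_mono)
    moreover have "0 \<le> ?p"
      by (rule LIMSEQ_le_const[OF convergent_prod_LIMSEQ[OF convergent_prod_c_factor]])
         (auto intro!: prod_nonneg less_imp_le[OF c_factor_bounds(1)])
    then have "0 \<le> ?q * ?p" using q(1) by simp
    moreover have "c_term j = ?p - 1 + ?q * ?p"
      by (simp add: c_term_def algebra_simps)
    moreover have "(0::real) \<le> (1/2) ^ j" by simp
    ultimately show ?thesis
      using prodinf_c_factor_bounds[of j] q unfolding real_norm_def abs_le_iff by linarith
  qed
  then show "\<exists>N. \<forall>n\<ge>N. norm (c_term n) \<le> 2 * (1/2) ^ n" by blast
qed (intro summable_mult summable_geometric, simp)

end

theory Submission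
  imports Defs "HOL-Number_Theory.Number_Theory"
begin

text \<open>The bound is proved by induction on \<open>k\<close>. For \<open>k = 0\<close>, complete sums over the period of \<open>b\<close>
  modulo \<open>m\<close> are bounded by \<open>sqrt m\<close> through Parseval's identity, incomplete sums follow by
  completion, and lifting the exponent shows that the period is \<open>m\<close> up to a constant factor. For the
  step, van der Corput's inequality is applied with shifts by multiples of \<open>\<tau> q\<close>, where \<open>q\<close> divides
  \<open>m\<close> and \<open>b^\<tau>\<close> is \<open>1\<close> modulo every prime factor of \<open>m\<close>. Then \<open>gcd (b^(\<tau> q h) - 1) m\<close> is \<open>q\<close> up to
  a factor \<open>O(gcd h m)\<close>, so that the correlations are exponential sums of the same shape with modulus
  about \<open>m / q\<close>. As \<open>m\<close> has boundedly many prime factors, \<open>q\<close> can be chosen of any prescribed size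
  up to a constant factor.

  The optimal size of \<open>q\<close> would give \<open>c k \<longlonglongrightarrow> -1\<close>. Any smaller size gives a valid bound as well,
  with a smaller \<open>c (k + 1)\<close>, which leaves the freedom to reach the limit \<open>c_const\<close>.\<close>

section \<open>Powers of \<open>b\<close> modulo the numbers over \<open>P\<close>\<close>

text \<open>Differencing bounds the square of the sum. The losses of a step are linear in the
  constants \<open>A\<close> and \<open>B\<close>, while the target square contains A^2 and B^2, so
  one pair of constants serves every \<open>k\<close>.

  The exponent of \<open>m\<close> obeys 1/\<alpha>' = 2/\<alpha> + 2, since \<open>q\<close> must
  carry the same power of \<open>m\<close> as the bound for the correlations; from \<alpha> = 1/2
  this yields 1/(2^(k+2) - 2).

  The obstacle is the prescribed limit. Lowering \<open>c k\<close> weakens the first term of the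
  bound and strengthens the second, so the bound with limit -1 does not imply the one with limit
  \<open>c_const\<close>. The decrease has to be made inside the recursion: a smaller
  \<open>q\<close> leaves correlations with a larger modulus, which moves both terms in exactly this
  way. Since \<open>q\<close> may only be lowered, \<open>c_const\<close> \<le> -1 is essential, and
  the decrease must not make the exponent \<gamma> of the second term negative. The numerical
  evaluation of \<open>c_const\<close> is thus a part of the argument.\<close>

lemma sum_powers_cong:
  fixes x p :: int
  assumes "p dvd x - 1"
  shows "[(\<Sum>i<n. x ^ i) = int n] (mod p)"
proof -
  have "[x = 1] (mod p)" using assms by (simp add: cong_iff_dvd_diff)
  then have "[x ^ i = 1] (mod p)" for i using cong_pow[of x 1 p i] by simp
  then have "[(\<Sum>i<n. x ^ i) = (\<Sum>i<n. 1)] (mod p)" by (intro cong_sum)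
  then show ?thesis by simp
qed

text \<open>Modulo p^2, x = 1 + p t has x^i = 1 + i p t, and for odd p the sum of the i below p is a
  multiple of p, which leaves the residue p. For p = 2 the sum is 1 + x, and x = 3 shows why x = 1
  modulo 4 is demanded.\<close>

lemma sum_powers_not_dvd_square:
  fixes x :: int and p :: nat
  assumes p: "prime p" and dvd: "int p dvd x - 1" and two: "p = 2 \<Longrightarrow> 4 dvd x - 1"
  shows "\<not> int p * int p dvd (\<Sum>i<p. x ^ i)"
proof (cases "p = 2")
  case True
  have "(\<Sum>i<p. x ^ i) = 1 + x" using True by (simp add: numeral_2_eq_2)
  then show ?thesis using True two by simp presburger
next
  case False
  from dvd obtain t where t: "x = 1 + int p * t" by (metis dvdE diff_eq_eq add.commute)
  have pow: "[x ^ i = 1 + int i * (int p * t)] (mod int p * int p)" for i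
  proof (induction i)
    case (Suc i)
    have "[x ^ Suc i = (1 + int i * (int p * t)) * x] (mod int p * int p)"
      using cong_mult[OF Suc cong_refl[of x]] by (simp add: mult.commute)
    moreover have "(1 + int i * (int p * t)) * x
        = 1 + int (Suc i) * (int p * t) + (int p * int p) * (int i * t * t)"
      by (simp add: t algebra_simps)
    ultimately show ?case by (metis cong_add_lcancel_0 cong_mult_self_left cong_trans)
  qed simp
  have "odd p" using p False primes_dvd_imp_eq two_is_prime_nat by blast
  then obtain r where r: "p = 2 * r + 1" by (elim oddE)
  have "(\<Sum>i<p. int i) = int p * int r"
  proof -
    have "2 * (\<Sum>i<n. int i) = int n * (int n - 1)" for n
      by (induction n) (simp_all add: algebra_simps)
    from this[of p] show ?thesis using r by simp
  qed
  then have "(\<Sum>i<p. 1 + int i * (int p * t)) = int p + int p * int p * (int r * t)"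
    by (simp add: sum.distrib flip: sum_distrib_right)
  moreover have "[(\<Sum>i<p. x ^ i) = (\<Sum>i<p. 1 + int i * (int p * t))] (mod int p * int p)"
    by (intro cong_sum pow)
  ultimately have "[(\<Sum>i<p. x ^ i) = int p] (mod int p * int p)"
    by (metis cong_add_lcancel_0 cong_mult_self_left cong_trans)
  then have "int p * int p dvd (\<Sum>i<p. x ^ i) \<longleftrightarrow> int p * int p dvd int p * 1"
    by (simp add: cong_dvd_iff)
  also have "\<dots> \<longleftrightarrow> int p dvd 1"
    using prime_gt_0_nat[OF p] by (subst dvd_mult_cancel_left) simp
  finally show ?thesis using prime_gt_1_nat[OF p] by simp
qed

text \<open>The divisibility form of lifting the exponent.\<close>
lemma prime_power_dvd_power_diff_1:
  fixes x :: int and p :: nat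
  assumes p: "prime p" and dvd: "int p dvd x - 1" and two: "p = 2 \<Longrightarrow> 4 dvd x - 1"
  shows "n > 0 \<Longrightarrow> int p ^ j dvd x ^ n - 1 \<Longrightarrow> int p ^ j dvd (x - 1) * int n"
proof (induction n arbitrary: j rule: less_induct)
  case (less n)
  have pp: "prime (int p)" using p by simp
  show ?case
  proof (cases "p dvd n")
    case False
    have eq: "x ^ n - 1 = (x - 1) * (\<Sum>i<n. x ^ i)" by (rule power_diff_1_eq)
    have "\<not> int p dvd (\<Sum>i<n. x ^ i)"
      using sum_powers_cong[OF dvd, of n] False by (simp add: cong_dvd_iff)
    then have "coprime (int p ^ j) (\<Sum>i<n. x ^ i)"
      using pp by (simp add: prime_imp_coprime coprime_power_left_iff)
    then have "int p ^ j dvd x - 1"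
      using less.prems(2) eq by (simp add: coprime_dvd_mult_left_iff)
    then show ?thesis by simp
  next
    case True
    then obtain n' where n': "n = p * n'" by blast
    have "n' > 0" "n' < n" using n' less.prems(1) prime_gt_1_nat[OF p] by auto
    define y where "y = x ^ n'"
    have "x - 1 dvd y - 1" unfolding y_def by (metis power_diff_1_eq dvd_triv_left)
    then have y: "int p dvd y - 1" "p = 2 \<Longrightarrow> 4 dvd y - 1"
      using dvd two by (blast intro: dvd_trans)+
    have "x ^ n - 1 = y ^ p - 1" by (simp add: y_def n' flip: power_mult mult.commute)
    also have "\<dots> = (y - 1) * (\<Sum>i<p. y ^ i)" by (rule power_diff_1_eq)
    finally have eq: "x ^ n - 1 = (y - 1) * (\<Sum>i<p. y ^ i)" .
    show ?thesis
    proof (cases j)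
      case (Suc i)
      \<comment> \<open>Passing from \<open>y\<close> to \<open>y ^ p\<close> gains exactly one
        factor \<open>p\<close>; it is cancelled against the factor \<open>p\<close> in
        \<open>n = p * n'\<close>.\<close>
      have "int p dvd (\<Sum>i<p. y ^ i)"
        using sum_powers_cong[OF y(1), of p] by (simp add: cong_dvd_iff)
      then obtain u where u: "(\<Sum>i<p. y ^ i) = int p * u" by blast
      have "\<not> int p dvd u" using sum_powers_not_dvd_square[OF p y] unfolding u by simp
      then have cop: "coprime (int p ^ i) u"
        using pp by (simp add: prime_imp_coprime coprime_power_left_iff)
      have "int p * int p ^ i dvd int p * ((y - 1) * u)"
        using less.prems(2) by (simp add: Suc eq u algebra_simps)
      then have "int p ^ i dvd (y - 1) * u" using prime_gt_0_nat[OF p] by simp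
      then have "int p ^ i dvd x ^ n' - 1"
        using cop by (simp add: coprime_dvd_mult_left_iff y_def)
      then have "int p ^ i dvd (x - 1) * int n'" using less.IH \<open>n' > 0\<close> \<open>n' < n\<close> by blast
      then have "int p * int p ^ i dvd int p * ((x - 1) * int n')" by (rule mult_dvd_mono[OF dvd_refl])
      then show ?thesis by (simp add: Suc n' algebra_simps)
    qed simp
  qed
qed

text \<open>This is \<tau>. The factors p - 1 come from Fermat's theorem. At p = 2 the factor is 2,
  because lifting the exponent asks for 1 modulo 4 there, which odd squares satisfy. Each factor is
  at most p, hence \<tau> \<le> \<open>\<Prod>P\<close>.\<close>

definition period_exp :: "nat set \<Rightarrow> nat"
  where "period_exp P = (\<Prod>p\<in>P. if p = 2 then 2 else p - 1)"

lemma period_exp_pos: "\<forall>p\<in>P. prime p \<Longrightarrow> 0 < period_exp P"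
  unfolding period_exp_def by (intro prod_pos) (use prime_gt_1_nat in auto)

lemma period_exp_le: "period_exp P \<le> \<Prod>P"
proof -
  have "period_exp P \<le> (\<Prod>p\<in>P. p)" unfolding period_exp_def by (intro prod_mono) auto
  then show ?thesis by simp
qed

lemma period_exp_dvd:
  fixes b :: nat
  assumes P: "finite P" "p \<in> P" and p: "prime p" "coprime p b"
  shows "int p dvd int b ^ period_exp P - 1" "p = 2 \<Longrightarrow> 4 dvd int b ^ period_exp P - 1"
proof -
  define r where "r = (if p = 2 then 2 else p - 1)"
  have "r dvd period_exp P" unfolding period_exp_def r_def using P by (intro dvd_prodI) auto
  then obtain k where k: "period_exp P = r * k" by blast
  have mono: "int b ^ r - 1 dvd int b ^ period_exp P - 1"
    unfolding k power_mult by (metis power_diff_1_eq dvd_triv_left)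
  have two: "4 dvd int b ^ r - 1" if "p = 2"
  proof -
    have "odd b" using p that by (simp add: coprime_left_2_iff_odd)
    then obtain c where "b = 2 * c + 1" by (elim oddE)
    then have "int b ^ r - 1 = 4 * (int c * int c + int c)"
      using that by (simp add: r_def power2_eq_square algebra_simps)
    then show ?thesis by simp
  qed
  have "int p dvd int b ^ r - 1"
  proof (cases "p = 2")
    case True
    then have "int p dvd 4" by simp
    then show ?thesis using two[OF True] by (rule dvd_trans)
  next
    case False
    have "\<not> p dvd b" using p by (metis coprime_absorb_left not_prime_unit)
    then have "[b ^ r = 1] (mod p)" using fermat_theorem[OF p(1)] False by (simp add: r_def)
    then have "[int (b ^ r) = int 1] (mod int p)" by (simp only: cong_int_iff)
    then show ?thesis by (simp add: cong_iff_dvd_diff)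
  qed
  then show "int p dvd int b ^ period_exp P - 1" using mono dvd_trans by blast
  show "4 dvd int b ^ period_exp P - 1" if "p = 2" using two[OF that] mono dvd_trans by blast
qed

lemma nats_over_dvd: "m \<in> nats_over P \<Longrightarrow> d dvd m \<Longrightarrow> d \<in> nats_over P"
  unfolding nats_over_def using dvd_prime_factors[of m d] dvd_pos_nat[of m d] by auto

lemma nats_over_prime: "m \<in> nats_over P \<Longrightarrow> prime p \<Longrightarrow> p dvd m \<Longrightarrow> p \<in> P"
  unfolding nats_over_def by (auto simp: prime_factors_dvd)

text \<open>Lifting the exponent, applied to each prime of \<open>m\<close> separately. With
  \<open>n\<close> the order of \<open>b\<close> modulo \<open>m\<close> it bounds that order from
  below; with \<open>n = q0 * h\<close> it bounds the factor by which a correlation shrinks the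
  modulus.\<close>

lemma gcd_power_diff_1_dvd:
  fixes b :: nat
  assumes P: "finite P" and m: "m \<in> nats_over P" "coprime m b" and b: "b > 1" and n: "n > 0"
    and pe: "period_exp P > 0"
  defines "x \<equiv> b ^ period_exp P"
  shows "gcd (x ^ n - 1) m dvd (x - 1) * n"
proof (rule multiplicity_le_imp_dvd)
  have m0: "m > 0" using m by (simp add: nats_over_def)
  show "gcd (x ^ n - 1) m \<noteq> 0" using m0 by simp
  have x1: "x > 1" unfolding x_def by (rule one_less_power[OF b pe])
  fix p :: nat assume p: "prime p"
  define j where "j = multiplicity p (gcd (x ^ n - 1) m)"
  show "multiplicity p (gcd (x ^ n - 1) m) \<le> multiplicity p ((x - 1) * n)"
  proof (cases "p dvd m")
    case True
    then have "p \<in> P" using nats_over_prime m p by blast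
    moreover have "coprime p b" using True m by (metis coprime_divisors dvd_refl)
    ultimately have d: "int p dvd int x - 1" "p = 2 \<Longrightarrow> 4 dvd int x - 1"
      unfolding x_def using period_exp_dvd[OF P _ p] by simp_all
    have "p ^ j dvd x ^ n - 1"
      using multiplicity_dvd[of p "gcd (x ^ n - 1) m"] unfolding j_def by simp
    then have "int (p ^ j) dvd int (x ^ n - 1)" by (simp only: int_dvd_int_iff)
    also have "int (x ^ n - 1) = int x ^ n - 1" using x1 by (subst of_nat_diff) auto
    finally have "int p ^ j dvd (int x - 1) * int n"
      using prime_power_dvd_power_diff_1[OF p d n] by simp
    also have "(int x - 1) * int n = int ((x - 1) * n)" using x1 by (simp add: of_nat_diff)
    finally have "p ^ j dvd (x - 1) * n" by (metis int_dvd_int_iff of_nat_power)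
    then show ?thesis unfolding j_def[symmetric]
      using p n x1 by (intro multiplicity_geI) (auto simp: prime_gt_1_nat)
  next
    case False
    then have "\<not> p dvd gcd (x ^ n - 1) m" by simp
    then show ?thesis by (simp add: not_dvd_imp_multiplicity_0)
  qed
qed

text \<open>The opposite direction, built up one prime at a time: x^(p q) - 1 is x^q - 1 times a sum
  of p terms that are all 1 modulo p. It guarantees that a shift by multiples of \<tau> q removes at
  least \<open>q\<close> from the modulus.\<close>

lemma dvd_power_self_diff_1:
  fixes b :: nat
  assumes P: "finite P" and m: "m \<in> nats_over P" "coprime m b" and b: "b > 0" and q: "q dvd m"
  defines "x \<equiv> b ^ period_exp P"
  shows "q dvd x ^ q - 1"
  using q
proof (induction q rule: prime_divisors_induct)
  case zero
  then show ?case using m by (simp add: nats_over_def)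
next
  case (unit u)
  then show ?case by simp
next
  case (factor p q)
  have pm: "p dvd m" "q dvd m" using factor.prems by (auto dest: dvd_mult_left dvd_mult_right)
  then have "p \<in> P" "coprime p b" using nats_over_prime m factor(1) 
    by (blast, metis coprime_divisors dvd_refl)
  then have d: "int p dvd int x - 1" using period_exp_dvd[OF P _ factor(1)] by (simp add: x_def)
  define y where "y = int x ^ q"
  have x0: "x > 0" using b by (simp add: x_def)
  have diff: "int (x ^ i - 1) = int x ^ i - 1" for i using x0 by (subst of_nat_diff) (auto simp: Suc_leI)
  have "int q dvd y - 1" using factor.IH[OF pm(2)] diff[of q] by (metis y_def int_dvd_int_iff)
  moreover have "int p dvd y - 1" unfolding y_def using d by (metis power_diff_1_eq dvd_mult2)
  then have "int p dvd (\<Sum>i<p. y ^ i)"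
    using sum_powers_cong[of "int p" y p] by (simp add: cong_dvd_iff)
  ultimately have "int q * int p dvd (y - 1) * (\<Sum>i<p. y ^ i)" by (rule mult_dvd_mono)
  also have "\<dots> = y ^ p - 1" by (rule power_diff_1_eq[symmetric])
  also have "\<dots> = int (x ^ (p * q) - 1)"
    unfolding diff by (simp add: y_def mult.commute flip: power_mult)
  finally show ?case by (metis int_dvd_int_iff of_nat_mult mult.commute)
qed

text \<open>Take the largest divisor up to \<open>y\<close>. If it is not \<open>m\<close>,
  multiplying it by a prime of the cofactor overshoots \<open>y\<close>, and that prime is at most
  \<open>\<Prod>P\<close>.\<close>

lemma exists_divisor_near:
  fixes y :: real
  assumes P: "finite P" "\<forall>p\<in>P. prime p" and m: "m \<in> nats_over P" and y: "1 \<le> y" "y \<le> real m"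
  shows "\<exists>q. q dvd m \<and> real q \<le> y \<and> y \<le> real (\<Prod>P) * real q"
proof -
  define D where "D = {q. q dvd m \<and> real q \<le> y}"
  have m0: "m > 0" using m by (simp add: nats_over_def)
  have fin: "finite D" unfolding D_def using m0 by simp
  have "1 \<in> D" using y by (simp add: D_def)
  define q where "q = Max D"
  have "q \<in> D" unfolding q_def using fin \<open>1 \<in> D\<close> by (intro Max_in) auto
  then have q: "q dvd m" "real q \<le> y" by (auto simp: D_def)
  have Q1: "\<Prod>P \<ge> 1" using P by (intro prod_ge_1) (auto dest: prime_gt_0_nat simp: Suc_le_eq)
  have "y \<le> real (\<Prod>P) * real q"
  proof (cases "q = m")
    case True
    have "1 * real q \<le> real (\<Prod>P) * real q" using Q1 by (intro mult_right_mono) (auto simp del: of_nat_prod)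
    moreover have "y \<le> real q" using True y(2) by simp
    ultimately show ?thesis by linarith
  next
    case False
    obtain k where k: "m = q * k" using q by blast
    with False have "k \<noteq> 1" by auto
    then obtain p where p: "prime p" "p dvd k" using prime_factor_nat by blast
    have "p \<in> P" using nats_over_prime[OF m p(1)] p(2) k by auto
    then have "p dvd \<Prod>P" using P by (intro dvd_prodI[where f="\<lambda>p. p", simplified]) auto
    then have "p \<le> \<Prod>P" using Q1 by (intro dvd_imp_le) auto
    have pq: "p * q dvd m" using p k by (simp add: mult.commute)
    have "y < real (p * q)"
    proof (rule ccontr)
      assume "\<not> y < real (p * q)"
      then have "p * q \<in> D" using pq by (simp add: D_def)
      then have "p * q \<le> Max D" by (rule Max_ge[OF fin])
      then have "p * q \<le> q" unfolding q_def[symmetric] .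
      moreover have "q > 0" using dvd_pos_nat[OF m0 q(1)] .
      ultimately show False using prime_gt_1_nat[OF p(1)] by simp
    qed
    also have "\<dots> \<le> real (\<Prod>P) * real q"
      using \<open>p \<le> \<Prod>P\<close> by (simp add: mult_right_mono del: of_nat_prod)
    finally show ?thesis by simp
  qed
  then show ?thesis using q by blast
qed

section \<open>Exponential sums over one period\<close>

definition unit_exp :: "real \<Rightarrow> complex"
  where "unit_exp x = cis (2 * pi * x)"

lemma unit_exp_0 [simp]: "unit_exp 0 = 1"
  by (simp add: unit_exp_def)

lemma norm_unit_exp [simp]: "norm (unit_exp x) = 1"
  by (simp add: unit_exp_def)

lemma unit_exp_add: "unit_exp (x + y) = unit_exp x * unit_exp y"
  by (simp add: unit_exp_def cis_mult distrib_left)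

lemma cnj_unit_exp: "cnj (unit_exp x) = unit_exp (- x)"
  by (simp add: unit_exp_def cis_cnj)

lemma unit_exp_power: "unit_exp x ^ n = unit_exp (real n * x)"
  by (simp add: unit_exp_def Complex.DeMoivre mult_ac)

lemma unit_exp_of_int [simp]: "unit_exp (of_int k) = 1"
  unfolding unit_exp_def by (rule cis_multiple_2pi) simp

lemma unit_exp_cong:
  assumes "[x = y] (mod int m)" and "m > 0"
  shows "unit_exp (of_int x / real m) = unit_exp (of_int y / real m)"
proof -
  from assms(1) obtain k where "x = y + int m * k"
    by (metis cong_iff_lin cong_sym)
  then have "of_int x / real m = of_int y / real m + of_int k"
    using assms(2) by (simp add: add_divide_distrib)
  then show ?thesis by (simp add: unit_exp_add)
qed

lemma cmod_1_minus_unit_exp: "cmod (1 - unit_exp x) = 2 * \<bar>sin (pi * x)\<bar>"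
proof -
  have c: "cos (2 * pi * x) = 1 - 2 * (sin (pi * x))\<^sup>2"
    using cos_double_sin[of "pi * x"] by (simp add: mult_ac)
  have "(cmod (1 - unit_exp x))\<^sup>2 = (1 - cos (2 * pi * x))\<^sup>2 + (sin (2 * pi * x))\<^sup>2"
    by (simp add: unit_exp_def cmod_power2)
  also have "\<dots> = 2 - 2 * cos (2 * pi * x)"
    using sin_cos_squared_add[of "2 * pi * x"] by (simp add: power2_eq_square algebra_simps)
  also have "\<dots> = (2 * \<bar>sin (pi * x)\<bar>)\<^sup>2"
    by (simp add: c power_mult_distrib)
  finally show ?thesis by (rule power2_eq_imp_eq) simp_all
qed

lemma unit_exp_eq_1_iff: "unit_exp x = 1 \<longleftrightarrow> x \<in> \<int>"
proof
  assume "unit_exp x = 1"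
  then have "cos (2 * pi * x) = 1" by (simp add: unit_exp_def complex_eq_iff)
  then obtain k :: int where "2 * pi * x = of_int k * 2 * pi"
    using cos_one_2pi_int by blast
  then have "x = of_int k" by simp
  then show "x \<in> \<int>" by simp
qed (auto elim!: Ints_cases)

text \<open>Orthogonality of additive characters, used modulo \<open>m\<close> for Parseval's
  identity and modulo the period for completion.\<close>

lemma sum_unit_exp_eq:
  assumes "T > 0"
  shows "(\<Sum>h<T. unit_exp (real h * (of_int k / real T))) = (if int T dvd k then of_nat T else 0)"
proof (cases "int T dvd k")
  case True
  then obtain j where "k = int T * j" by blast
  then have "real h * (of_int k / real T) = of_int (int h * j)" for h
    using assms by simp
  then show ?thesis using True by (simp only: unit_exp_of_int) simp
next
  case False
  let ?w = "unit_exp (of_int k / real T)"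
  have "?w \<noteq> 1"
  proof
    assume "?w = 1"
    then obtain j where "of_int k / real T = of_int j" by (auto simp: unit_exp_eq_1_iff elim: Ints_cases)
    then have "of_int k = (of_int (int T * j) :: real)" using assms by (simp add: field_simps)
    then have "k = int T * j" by (simp only: of_int_eq_iff)
    then show False using False by simp
  qed
  moreover have "?w ^ T = 1" using assms by (simp add: unit_exp_power)
  ultimately have "(\<Sum>h<T. ?w ^ h) = 0" by (simp add: geometric_sum)
  then show ?thesis using False by (simp add: unit_exp_power)
qed

text \<open>With t = pi x \<le> 2, the Taylor bound gives sin t \<ge> t - t^3/6 \<ge> t/3, and t
  \<ge> 3 x. Only 3 < pi < 4 enters; the result loses a factor 2 against Jordan's
  inequality.\<close>

lemma sin_pi_ge:
  assumes "0 \<le> x" "x \<le> 1 / 2"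
  shows "x \<le> sin (pi * x)"
proof -
  define t where "t = pi * x"
  have t0: "0 \<le> t" using assms by (simp add: t_def)
  have "t \<le> 4 * (1/2)" unfolding t_def using assms pi_less_4 by (intro mult_mono) auto
  then have "t * t \<le> 2 * 2" using t0 by (intro mult_mono) auto
  have "\<bar>sin t - (\<Sum>m<3. sin_coeff m * t ^ m)\<bar> \<le> inverse (fact 3) * \<bar>t\<bar> ^ 3"
    by (rule Maclaurin_sin_bound)
  then have "\<bar>sin t - t\<bar> \<le> t ^ 3 / 6"
    using t0 by (simp add: sin_coeff_def eval_nat_numeral)
  moreover have "t ^ 3 / 6 \<le> 2 * t / 3"
    using mult_right_mono[OF \<open>t * t \<le> 2 * 2\<close> t0] by (simp add: eval_nat_numeral)
  moreover have "3 * x \<le> t" unfolding t_def using assms pi_gt3 by (intro mult_right_mono) auto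
  ultimately show ?thesis unfolding t_def[symmetric] by linarith
qed

lemma inverse_sin_pi_le:
  assumes "0 < x" "x < 1"
  shows "0 < sin (pi * x)" "1 / sin (pi * x) \<le> 1 / x + 1 / (1 - x)"
proof -
  have sym: "sin (pi * (1 - x)) = sin (pi * x)" by (simp add: right_diff_distrib)
  have "x \<le> sin (pi * x) \<or> 1 - x \<le> sin (pi * x)"
    using sin_pi_ge[of x] sin_pi_ge[of "1 - x"] assms unfolding sym by linarith
  then have "0 < sin (pi * x) \<and> (1 / sin (pi * x) \<le> 1 / x \<or> 1 / sin (pi * x) \<le> 1 / (1 - x))"
    using assms by (auto intro!: divide_left_mono mult_pos_pos)
  moreover have "0 < 1 / x" "0 < 1 / (1 - x)" using assms by simp_all
  ultimately show "0 < sin (pi * x)" "1 / sin (pi * x) \<le> 1 / x + 1 / (1 - x)"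
    by linarith+
qed

lemma harm_le_1_plus_ln: "n > 0 \<Longrightarrow> harm n \<le> 1 + ln (real n)"
proof (induction n rule: nat_induct_non_zero)
  case (Suc n)
  have "ln (real n / real (Suc n)) \<le> real n / real (Suc n) - 1"
    using Suc by (intro ln_le_minus_one) simp
  also have "\<dots> = - inverse (real (Suc n))" by (simp add: field_simps)
  finally have "inverse (real (Suc n)) \<le> ln (real (Suc n)) - ln (real n)"
    using Suc by (simp add: ln_div)
  then show ?case using Suc by (simp add: harm_Suc)
qed (simp add: harm_def)

text \<open>Frequency 0 contributes \<open>r\<close>. Any other contributes at most 1/sin(pi h/T),
  split into its poles at both ends of the period; the reflection h to T - h turns both parts into
  the same harmonic sum. The logarithm of the theorem originates here.\<close>

lemma sum_norm_geometric_le: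
  assumes "T > 0"
  shows "(\<Sum>h<T. norm (\<Sum>k<r. unit_exp (- (real h / real T) * real k)))
    \<le> real r + 2 * real T * (1 + ln (real T))"
proof -
  let ?g = "\<lambda>h. norm (\<Sum>k<r. unit_exp (- (real h / real T) * real k))"
  have g: "?g h \<le> real T / real h + real T / real (T - h)" if "h \<in> {1..<T}" for h
  proof -
    define x where "x = real h / real T"
    have x: "0 < x" "x < 1" using that by (auto simp: x_def)
    have s: "0 < sin (pi * x)" "1 / sin (pi * x) \<le> 1 / x + 1 / (1 - x)"
      by (rule inverse_sin_pi_le[OF x])+
    let ?w = "unit_exp (- x)"
    have n: "norm (1 - ?w) = 2 * sin (pi * x)" using s(1) by (simp add: cmod_1_minus_unit_exp)
    then have "?w \<noteq> 1" using s(1) by auto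
    then have "(\<Sum>k<r. ?w ^ k) = (1 - ?w ^ r) / (1 - ?w)"
      by (simp add: geometric_sum divide_simps) (simp add: algebra_simps)
    then have "norm (\<Sum>k<r. ?w ^ k) = norm (1 - ?w ^ r) / (2 * sin (pi * x))"
      by (simp add: norm_divide n)
    also have "\<dots> \<le> 2 / (2 * sin (pi * x))"
      using s(1) norm_triangle_ineq4[of 1 "?w ^ r"] by (intro divide_right_mono) (auto simp: norm_power)
    also have "\<dots> \<le> 1 / x + 1 / (1 - x)" using s by simp
    also have "1 / x = real T / real h" by (simp add: x_def)
    also have "1 - x = real (T - h) / real T" using that by (simp add: x_def of_nat_diff diff_divide_distrib)
    finally show ?thesis by (simp add: unit_exp_power x_def mult.commute)
  qed
  have "{..<T} = insert 0 {1..<T}" using assms by auto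
  then have "(\<Sum>h<T. ?g h) = ?g 0 + (\<Sum>h\<in>{1..<T}. ?g h)" by simp
  also have "?g 0 = real r" by simp
  also have "(\<Sum>h\<in>{1..<T}. ?g h) \<le> (\<Sum>h\<in>{1..<T}. real T / real h + real T / real (T - h))"
    by (intro sum_mono g)
  also have "\<dots> = (\<Sum>h\<in>{1..<T}. real T / real h) + (\<Sum>h\<in>{1..<T}. real T / real (T - h))"
    by (rule sum.distrib)
  also have "(\<Sum>h\<in>{1..<T}. real T / real (T - h)) = (\<Sum>h\<in>{1..<T}. real T / real h)"
    by (intro sum.reindex_bij_witness[of _ "\<lambda>h. T - h" "\<lambda>h. T - h"]) auto
  also have "(\<Sum>h\<in>{1..<T}. real T / real h) \<le> real T * (1 + ln (real T))"
  proof -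
    have "(\<Sum>h\<in>{1..<T}. real T / real h) = real T * harm (T - 1)"
      unfolding harm_def sum_distrib_left using assms
      by (intro sum.cong) (auto simp: divide_inverse)
    also have "\<dots> \<le> real T * harm T" by (intro mult_left_mono harm_mono) auto
    also have "\<dots> \<le> real T * (1 + ln (real T))" by (intro mult_left_mono harm_le_1_plus_ln assms) auto
    finally show ?thesis .
  qed
  finally show ?thesis by simp
qed

text \<open>The exponents start at 0, those of the theorem at 1. The shift is absorbed by passing
  from \<open>a\<close> to \<open>a * b\<close>, which is still coprime to \<open>m\<close>.\<close>

definition exp_sum :: "nat \<Rightarrow> nat \<Rightarrow> int \<Rightarrow> nat \<Rightarrow> complex"
  where "exp_sum b m a N = (\<Sum>n<N. unit_exp (of_int (a * int b ^ n) / real m))"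

section \<open>Complete and incomplete sums over the order of \<open>b\<close> modulo
  \<open>m\<close>\<close>

locale power_residues =
  fixes b m T :: nat
  assumes m: "m > 0" and T: "T > 0" and cong_T: "[b ^ T = 1] (mod m)"
    and cop: "coprime m b"
    and minimal: "\<And>i. 0 < i \<Longrightarrow> i < T \<Longrightarrow> \<not> [b ^ i = 1] (mod m)"
begin

lemma cong_powerD:
  assumes "[int b ^ i = int b ^ j] (mod int m)" "i < T" "j < T"
  shows "i = j"
proof -
  have *: "i = j" if "[int b ^ i = int b ^ j] (mod int m)" "i \<le> j" "j < T" for i j
  proof (rule ccontr)
    assume "i \<noteq> j"
    have "[b ^ i * 1 = b ^ i * b ^ (j - i)] (mod m)"
      using that by (simp flip: cong_int_iff power_add)
    moreover have "coprime (b ^ i) m" using cop by (simp add: coprime_commute)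
    ultimately have "[b ^ (j - i) = 1] (mod m)" using cong_mult_lcancel_nat cong_sym by blast
    moreover have "0 < j - i" "j - i < T" using \<open>i \<noteq> j\<close> that by linarith+
    ultimately show False using minimal by blast
  qed
  show ?thesis using *[of i j] *[of j i] assms by (metis cong_sym linorder_le_cases)
qed

lemma inj_on_residue:
  assumes "coprime a (int m)"
  shows "inj_on (\<lambda>i. a * int b ^ i mod int m) {..<T}"
proof (rule inj_onI)
  fix i j assume ij: "i \<in> {..<T}" "j \<in> {..<T}" "a * int b ^ i mod int m = a * int b ^ j mod int m"
  then have "[a * int b ^ i = a * int b ^ j] (mod int m)" by (simp add: cong_def)
  then have "[int b ^ i = int b ^ j] (mod int m)" using assms cong_mult_lcancel by blast
  then show "i = j" using ij cong_powerD by simp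
qed

lemma residue_in: "a mod int m \<in> {0..<int m}"
  using m by simp

lemma T_le: "T \<le> m"
proof -
  have "card {..<T} \<le> card {0..<int m}"
    by (rule card_inj_on_le[OF inj_on_residue[of 1]]) (use m in auto)
  then show ?thesis by simp
qed

text \<open>A Fourier coefficient, at frequency \<open>h\<close>, of a sequence with period
  \<open>T\<close>. The twists by \<open>h\<close> are there for completion; \<open>h = 0\<close> is
  the plain sum over a period.\<close>

definition complete_sum :: "int \<Rightarrow> int \<Rightarrow> complex"
  where "complete_sum h x = (\<Sum>n<T. unit_exp (of_int (x * int b ^ n) / real m) * unit_exp (real n * (of_int h / real T)))"

lemma complete_sum_mod: "complete_sum h (x mod int m) = complete_sum h x"
proof -
  have "[x mod int m * int b ^ n = x * int b ^ n] (mod int m)" for n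
    by (intro cong_mult) auto
  then show ?thesis unfolding complete_sum_def
    by (intro sum.cong refl arg_cong2[where f="(*)"] unit_exp_cong m)
qed

lemma unit_exp_shift_T:
  "unit_exp (of_int (x * int b ^ (n + T)) / real m) = unit_exp (of_int (x * int b ^ n) / real m)"
proof (rule unit_exp_cong[OF _ m])
  have "[int b ^ T = 1] (mod int m)" using cong_T by (simp flip: cong_int_iff)
  then have "[x * int b ^ n * int b ^ T = x * int b ^ n * 1] (mod int m)" by (rule cong_scalar_left)
  then show "[x * int b ^ (n + T) = x * int b ^ n] (mod int m)" by (simp add: power_add mult.assoc)
qed

text \<open>Multiplication by \<open>b\<close> shifts the summation index by one around the period,
  which changes the twist by a constant of modulus 1.\<close>

lemma norm_complete_sum_times: "norm (complete_sum h (x * int b)) = norm (complete_sum h x)"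
proof -
  define F where "F n = unit_exp (of_int (x * int b ^ n) / real m) * unit_exp (real n * (of_int h / real T))" for n
  have FT: "F T = F 0"
    using unit_exp_shift_T[of x 0] T by (simp add: F_def)
  have "complete_sum h (x * int b) * unit_exp (of_int h / real T) = (\<Sum>n<T. F (Suc n))"
    unfolding complete_sum_def sum_distrib_right F_def
    by (intro sum.cong) (auto simp: mult_ac unit_exp_add[symmetric] ring_distribs add_divide_distrib add_ac)
  also have "\<dots> = (\<Sum>n<T. F n)"
    using sum.lessThan_Suc_shift[of F T] FT by simp
  also have "\<dots> = complete_sum h x" by (simp add: complete_sum_def F_def)
  finally show ?thesis by (metis norm_mult norm_unit_exp mult_1_right)
qed

lemma norm_complete_sum_times_power:
  "norm (complete_sum h (x * int b ^ i)) = norm (complete_sum h x)"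
proof (induction i)
  case (Suc i)
  then show ?case using norm_complete_sum_times[of h "x * int b ^ i"] by (simp add: mult_ac)
qed simp

text \<open>Opening the square and summing over \<open>x\<close> first leaves the pairs with b^i =
  b^j modulo \<open>m\<close>; below the order these are only the diagonal ones.\<close>

lemma sum_norm_complete_sum_square:
  "(\<Sum>x<m. (norm (complete_sum h (int x)))\<^sup>2) = real m * real T"
proof -
  let ?e = "\<lambda>n. unit_exp (real n * (of_int h / real T))"
  let ?u = "\<lambda>x n. unit_exp (of_int (int x * int b ^ n) / real m)"
  have "(of_real (\<Sum>x<m. (norm (complete_sum h (int x)))\<^sup>2) :: complex)
      = (\<Sum>x<m. complete_sum h (int x) * cnj (complete_sum h (int x)))"
    by (simp only: of_real_sum complex_norm_square)
  also have "\<dots> = (\<Sum>x<m. \<Sum>i<T. \<Sum>j<T. (?u x i * ?e i) * cnj (?u x j * ?e j))"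
    unfolding complete_sum_def by (simp add: sum_product)
  also have "\<dots> = (\<Sum>i<T. \<Sum>x<m. \<Sum>j<T. (?u x i * ?e i) * cnj (?u x j * ?e j))"
    by (rule sum.swap)
  also have "\<dots> = (\<Sum>i<T. \<Sum>j<T. \<Sum>x<m. (?u x i * ?e i) * cnj (?u x j * ?e j))"
    by (intro sum.cong refl sum.swap)
  also have "\<dots> = (\<Sum>i<T. \<Sum>j<T. (?e i * cnj (?e j)) * (if i = j then of_nat m else 0))"
  proof (intro sum.cong refl)
    fix i j assume ij: "i \<in> {..<T}" "j \<in> {..<T}"
    have "(\<Sum>x<m. (?u x i * ?e i) * cnj (?u x j * ?e j))
        = (?e i * cnj (?e j)) * (\<Sum>x<m. ?u x i * cnj (?u x j))"
      by (simp add: sum_distrib_left mult_ac)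
    also have "(\<Sum>x<m. ?u x i * cnj (?u x j))
        = (\<Sum>x<m. unit_exp (real x * (of_int (int b ^ i - int b ^ j) / real m)))"
    proof (intro sum.cong refl)
      fix x
      have "of_int (int x * int b ^ i) / real m + - (of_int (int x * int b ^ j) / real m)
          = real x * (of_int (int b ^ i - int b ^ j) / real m)"
        by (simp add: right_diff_distrib diff_divide_distrib)
      then show "?u x i * cnj (?u x j) = unit_exp (real x * (of_int (int b ^ i - int b ^ j) / real m))"
        unfolding cnj_unit_exp unit_exp_add[symmetric] by (simp only:)
    qed
    also have "\<dots> = (if int m dvd int b ^ i - int b ^ j then of_nat m else 0)"
      by (rule sum_unit_exp_eq[OF m])
    also have "(int m dvd int b ^ i - int b ^ j) = (i = j)"
      using cong_powerD[of i j] ij by (auto simp: cong_iff_dvd_diff)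
    finally show "(\<Sum>x<m. (?u x i * ?e i) * cnj (?u x j * ?e j))
        = (?e i * cnj (?e j)) * (if i = j then of_nat m else 0)" .
  qed
  also have "\<dots> = (\<Sum>i<T. (?e i * cnj (?e i)) * of_nat m)"
    by (intro sum.cong refl) (simp add: if_distrib cong: if_cong)
  also have "\<dots> = (of_real (real m * real T) :: complex)"
    by (simp add: complex_norm_square[symmetric])
  finally show ?thesis by (simp only: of_real_eq_iff)
qed

text \<open>Since \<open>|complete_sum h x|\<close> is invariant under \<open>x \<mapsto> x b\<close>, it takes the value at \<open>a\<close>
  on \<open>T\<close> residues, so that Parseval's identity bounds it.\<close>
lemma norm_complete_sum_le:
  assumes "coprime a (int m)"
  shows "norm (complete_sum h a) \<le> sqrt (real m)"
proof -
  let ?g = "\<lambda>x. (norm (complete_sum h x))\<^sup>2"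
  let ?r = "\<lambda>i. a * int b ^ i mod int m"
  have "real T * ?g a = (\<Sum>i<T. ?g (?r i))"
    by (simp add: complete_sum_mod norm_complete_sum_times_power)
  also have "\<dots> = (\<Sum>x\<in>?r ` {..<T}. ?g x)"
    by (simp add: sum.reindex[OF inj_on_residue[OF assms]])
  also have "\<dots> \<le> (\<Sum>x\<in>{0..<int m}. ?g x)"
    using residue_in by (intro sum_mono2) auto
  also have "\<dots> = (\<Sum>x<m. ?g (int x))"
    by (intro sum.reindex_bij_witness[of _ int nat]) auto
  also have "\<dots> = real m * real T" by (rule sum_norm_complete_sum_square)
  finally have "?g a \<le> real m" using T by simp
  then show ?thesis by (rule real_le_rsqrt)
qed

lemma exp_sum_add_T: "exp_sum b m a (N + T) = complete_sum 0 a + exp_sum b m a N"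
proof -
  let ?f = "\<lambda>n. unit_exp (of_int (a * int b ^ n) / real m)"
  have "exp_sum b m a (N + T) = sum ?f {..<T} + sum ?f {T..<N + T}"
    unfolding exp_sum_def by (subst sum.union_disjoint[symmetric]) (auto intro!: sum.cong)
  also have "sum ?f {T..<N + T} = (\<Sum>n<N. ?f (n + T))"
    using sum.shift_bounds_nat_ivl[of ?f 0 T N] by (simp add: lessThan_atLeast0 add.commute)
  also have "\<dots> = exp_sum b m a N" unfolding exp_sum_def by (simp only: unit_exp_shift_T)
  finally show ?thesis by (simp add: complete_sum_def)
qed

text \<open>Completion: the characters modulo \<open>T\<close> detect the condition n < r, so
  \<open>T\<close> times the incomplete sum is a combination of complete sums, each at most sqrt m,
  weighted by geometric sums of total size T (3 + 2 ln T).\<close>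

lemma norm_exp_sum_incomplete:
  assumes a: "coprime a (int m)" and r: "r \<le> T"
  shows "norm (exp_sum b m a r) \<le> sqrt (real m) * (3 + 2 * ln (real T))"
proof -
  let ?f = "\<lambda>n. unit_exp (of_int (a * int b ^ n) / real m)"
  let ?w = "\<lambda>h k. unit_exp (- (real h / real T) * real k)"
  have "(\<Sum>h<T. complete_sum (int h) a * (\<Sum>k<r. ?w h k))
      = (\<Sum>h<T. \<Sum>n<T. \<Sum>k<r. ?f n * unit_exp (real h * (of_int (int n - int k) / real T)))"
    unfolding complete_sum_def sum_product
  proof (intro sum.cong refl)
    fix h n k
    have "real n * (of_int (int h) / real T) + - (real h / real T) * real k
        = real h * (of_int (int n - int k) / real T)"
      by (simp add: diff_divide_distrib right_diff_distrib)
    then have "unit_exp (real n * (of_int (int h) / real T)) * ?w h k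
        = unit_exp (real h * (of_int (int n - int k) / real T))"
      by (simp only: unit_exp_add[symmetric])
    then show "?f n * unit_exp (real n * (of_int (int h) / real T)) * ?w h k
        = ?f n * unit_exp (real h * (of_int (int n - int k) / real T))"
      by (simp only: mult.assoc)
  qed
  also have "\<dots> = (\<Sum>n<T. \<Sum>h<T. \<Sum>k<r. ?f n * unit_exp (real h * (of_int (int n - int k) / real T)))"
    by (rule sum.swap)
  also have "\<dots> = (\<Sum>n<T. \<Sum>k<r. \<Sum>h<T. ?f n * unit_exp (real h * (of_int (int n - int k) / real T)))"
    by (intro sum.cong refl sum.swap)
  also have "\<dots> = (\<Sum>n<T. \<Sum>k<r. ?f n * (if n = k then of_nat T else 0))"
  proof (intro sum.cong refl)
    fix n k assume "n \<in> {..<T}" "k \<in> {..<r}"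
    then have "int T dvd int n - int k \<longleftrightarrow> n = k"
      using r zdvd_imp_le[of "int T" "\<bar>int n - int k\<bar>"] by (cases "n = k") auto
    then show "(\<Sum>h<T. ?f n * unit_exp (real h * (of_int (int n - int k) / real T)))
        = ?f n * (if n = k then of_nat T else 0)"
      by (simp only: sum_distrib_left[symmetric] sum_unit_exp_eq[OF T])
  qed
  also have "\<dots> = (\<Sum>n<T. if n < r then ?f n * of_nat T else 0)"
    by (intro sum.cong refl) (simp add: if_distrib cong: if_cong)
  also have "\<dots> = (\<Sum>n<r. ?f n * of_nat T)"
    using r by (intro sum.mono_neutral_cong_right) auto
  also have "\<dots> = of_nat T * exp_sum b m a r"
    by (simp add: exp_sum_def sum_distrib_left mult.commute)
  finally have "real T * norm (exp_sum b m a r) = norm (\<Sum>h<T. complete_sum (int h) a * (\<Sum>k<r. ?w h k))"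
    by (simp add: norm_mult)
  also have "\<dots> \<le> (\<Sum>h<T. sqrt (real m) * norm (\<Sum>k<r. ?w h k))"
    by (intro order_trans[OF norm_sum] sum_mono)
       (simp add: norm_mult mult_right_mono norm_complete_sum_le[OF a])
  also have "\<dots> \<le> sqrt (real m) * (real r + 2 * real T * (1 + ln (real T)))"
    unfolding sum_distrib_left[symmetric] by (intro mult_left_mono sum_norm_geometric_le T) simp
  also have "\<dots> \<le> sqrt (real m) * (real T + 2 * real T * (1 + ln (real T)))"
    using r by (intro mult_left_mono) auto
  also have "\<dots> = real T * (sqrt (real m) * (3 + 2 * ln (real T)))" by (simp add: algebra_simps)
  finally show ?thesis using T by simp
qed

text \<open>Cut into full periods, each costing sqrt m, and one incomplete remainder;
  \<open>T \<le> m\<close> puts \<open>m\<close> into the logarithm.\<close>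

lemma norm_exp_sum_le:
  assumes a: "coprime a (int m)"
  shows "norm (exp_sum b m a N) \<le> sqrt (real m) * (3 * (1 + ln (real m))) + real N / real T * sqrt (real m)"
proof -
  have split: "norm (exp_sum b m a (r + k * T)) \<le> real k * sqrt (real m) + norm (exp_sum b m a r)" for r k
  proof (induction k)
    case (Suc k)
    have "exp_sum b m a (r + Suc k * T) = complete_sum 0 a + exp_sum b m a (r + k * T)"
      using exp_sum_add_T[of a "r + k * T"] by (simp add: add_ac)
    then have "norm (exp_sum b m a (r + Suc k * T))
        \<le> norm (complete_sum 0 a) + norm (exp_sum b m a (r + k * T))"
      by (simp only: norm_triangle_ineq)
    then show ?case using Suc norm_complete_sum_le[OF a, of 0] by (simp add: distrib_right)
  qed simp
  have "norm (exp_sum b m a N) \<le> real (N div T) * sqrt (real m) + norm (exp_sum b m a (N mod T))"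
    using split[of "N mod T" "N div T"] by simp
  moreover have "real (N div T) * sqrt (real m) \<le> real N / real T * sqrt (real m)"
    by (intro mult_right_mono of_nat_div_le_of_nat) simp
  moreover have "norm (exp_sum b m a (N mod T)) \<le> sqrt (real m) * (3 + 2 * ln (real T))"
    using T by (intro norm_exp_sum_incomplete[OF a]) simp
  moreover have "sqrt (real m) * (3 + 2 * ln (real T)) \<le> sqrt (real m) * (3 * (1 + ln (real m)))"
  proof (intro mult_left_mono)
    have "ln (real T) \<le> ln (real m)" using T T_le by simp
    moreover have "0 \<le> ln (real m)" using m by simp
    ultimately show "3 + 2 * ln (real T) \<le> 3 * (1 + ln (real m))" by (simp add: distrib_left)
  qed simp
  ultimately show ?thesis by linarith
qed

end

section \<open>Van der Corput differencing\<close>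

text \<open>Averaging over the shifts by q h, h < H, leaves the full sum unchanged; Cauchy-Schwarz
  over the enlarged window then produces the correlations. The window has length N + q H \<le> 2 N,
  whence the factor 2 N.\<close>

lemma van_der_corput_shift:
  fixes f :: "nat \<Rightarrow> complex"
  assumes H: "H > 0" and qH: "q * H \<le> N" and f: "\<And>n. norm (f n) \<le> 1"
  shows "(norm (\<Sum>n<N. f n))\<^sup>2 \<le> 2 * real N / real H *
    (real N + 2 * (\<Sum>h\<in>{1..<H}. norm (\<Sum>n<N - q * h. f (n + q * h) * cnj (f n))))"
proof -
  \<comment> \<open>Extension by zero to all integers makes the shifted sums equal without boundary
    terms.\<close>
  define g where "g i = (if 0 \<le> i \<and> i < int N then f (nat i) else 0)" for i :: int
  define J where "J = {0..<int (N + q * H)}"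
  define D where "D h = norm (\<Sum>n<N - q * h. f (n + q * h) * cnj (f n))" for h
  define C where "C h k = (\<Sum>i\<in>J. g (i - int (q * h)) * cnj (g (i - int (q * k))))" for h k
  let ?S = "\<Sum>n<N. f n"
  have shift: "(\<Sum>i\<in>J. g (i - int (q * h))) = ?S" if "h < H" for h
  proof -
    have "q * h \<le> q * H" using that by simp
    then have "(\<Sum>i\<in>J. g (i - int (q * h))) = (\<Sum>i\<in>{int (q * h)..<int (N + q * h)}. g (i - int (q * h)))"
      unfolding J_def by (intro sum.mono_neutral_right) (auto simp: g_def simp del: of_nat_mult)
    also have "\<dots> = ?S"
      by (intro sum.reindex_bij_witness[of _ "\<lambda>n. int (n + q * h)" "\<lambda>i. nat (i - int (q * h))"])
         (auto simp: g_def nat_diff_distrib simp del: of_nat_mult)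
    finally show ?thesis .
  qed
  have C_le: "norm (C h k) \<le> D (k - h)" if "h \<le> k" "k < H" for h k
  proof -
    define d where "d = q * (k - h)"
    have d: "int (q * k) = int (q * h) + int d"
      using that by (simp add: d_def right_diff_distrib of_nat_diff)
    have qk: "q * k \<le> q * H" using that by simp
    have "C h k = (\<Sum>i\<in>{int (q * k)..<int (N + q * h)}. g (i - int (q * h)) * cnj (g (i - int (q * k))))"
      unfolding J_def C_def using qk d that
      by (intro sum.mono_neutral_right) (auto simp: g_def simp del: of_nat_mult)
    also have "\<dots> = (\<Sum>n<N - d. f (n + d) * cnj (f n))"
    proof (intro sum.reindex_bij_witness[of _ "\<lambda>n. int (n + q * k)" "\<lambda>i. nat (i - int (q * k))"])
      fix i assume "i \<in> {int (q * k)..<int (N + q * h)}"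
      then have i: "int (q * k) \<le> i" "i < int N + int (q * h)" by simp_all
      then show "int (nat (i - int (q * k)) + q * k) = i" "nat (i - int (q * k)) \<in> {..<N - d}"
        using d by (simp_all del: of_nat_mult)
      have "nat (i - int (q * k)) + d = nat (i - int (q * h))" using i d by linarith
      then show "f (nat (i - int (q * k)) + d) * cnj (f (nat (i - int (q * k))))
          = g (i - int (q * h)) * cnj (g (i - int (q * k)))"
        using i d by (simp add: g_def del: of_nat_mult)
    next
      fix n assume "n \<in> {..<N - d}"
      then have "int n + int d < int N" by auto
      then show "nat (int (n + q * k) - int (q * k)) = n" "int (n + q * k) \<in> {int (q * k)..<int (N + q * h)}"
        using d by (simp_all del: of_nat_mult)
    qed
    finally show ?thesis by (simp add: D_def d_def)
  qed
  have C_cnj: "C h k = cnj (C k h)" for h k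
    unfolding C_def by (simp add: mult.commute)
  have C_le': "norm (C h k) \<le> D (if h \<le> k then k - h else h - k)" if "h < H" "k < H" for h k
    using C_le[of h k] C_le[of k h] C_cnj[of h k] that by (auto simp: complex_mod_cnj)
  have D0: "D h \<ge> 0" for h by (simp add: D_def)
  have "of_nat H * ?S = (\<Sum>h<H. \<Sum>i\<in>J. g (i - int (q * h)))"
    using shift by simp
  also have "\<dots> = (\<Sum>i\<in>J. \<Sum>h<H. g (i - int (q * h)))" by (rule sum.swap)
  finally have "real H * norm ?S = norm (\<Sum>i\<in>J. \<Sum>h<H. g (i - int (q * h)))"
    by (metis norm_mult norm_of_nat)
  then have "(real H * norm ?S)\<^sup>2 \<le> (\<Sum>i\<in>J. norm (\<Sum>h<H. g (i - int (q * h))))\<^sup>2"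
    by (auto intro!: power_mono norm_sum)
  also have "\<dots> \<le> (\<Sum>i\<in>J. (norm (\<Sum>h<H. g (i - int (q * h))))\<^sup>2) * real (card J)"
    by (rule sum_squared_le_sum_of_squares)
  also have "(\<Sum>i\<in>J. (norm (\<Sum>h<H. g (i - int (q * h))))\<^sup>2)
      \<le> real H * (real N + 2 * (\<Sum>h\<in>{1..<H}. D h))"
  proof -
    have "(of_real (\<Sum>i\<in>J. (norm (\<Sum>h<H. g (i - int (q * h))))\<^sup>2) :: complex)
        = (\<Sum>i\<in>J. \<Sum>h<H. \<Sum>k<H. g (i - int (q * h)) * cnj (g (i - int (q * k))))"
      by (simp only: of_real_sum complex_norm_square cnj_sum sum_product)
    also have "\<dots> = (\<Sum>h<H. \<Sum>i\<in>J. \<Sum>k<H. g (i - int (q * h)) * cnj (g (i - int (q * k))))"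
      by (rule sum.swap)
    also have "\<dots> = (\<Sum>h<H. \<Sum>k<H. C h k)"
      unfolding C_def by (intro sum.cong refl sum.swap)
    finally have "norm (of_real (\<Sum>i\<in>J. (norm (\<Sum>h<H. g (i - int (q * h))))\<^sup>2) :: complex)
        = norm (\<Sum>h<H. \<Sum>k<H. C h k)" by (rule arg_cong)
    then have "(\<Sum>i\<in>J. (norm (\<Sum>h<H. g (i - int (q * h))))\<^sup>2) = norm (\<Sum>h<H. \<Sum>k<H. C h k)"
      by (simp only: norm_of_real abs_of_nonneg[OF sum_nonneg[OF zero_le_power2]])
    also have "\<dots> \<le> (\<Sum>h<H. \<Sum>k<H. norm (C h k))"
      by (intro order_trans[OF norm_sum] sum_mono norm_sum)
    also have "\<dots> \<le> (\<Sum>h<H. real N + 2 * (\<Sum>d\<in>{1..<H}. D d))"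
    proof (rule sum_mono)
      fix h assume h: "h \<in> {..<H}"
      \<comment> \<open>In each row every lag between 1 and H - 1 occurs at most once on either side
        of the diagonal, which accounts for the factor 2.\<close>
      have "{..<H} = {..<h} \<union> ({h} \<union> {h<..<H})" using h by auto
      then have "(\<Sum>k<H. norm (C h k)) = (\<Sum>k\<in>{..<h} \<union> ({h} \<union> {h<..<H}). norm (C h k))"
        by (rule arg_cong)
      also have "\<dots> = (\<Sum>k<h. norm (C h k)) + (\<Sum>k\<in>{h} \<union> {h<..<H}. norm (C h k))"
        by (rule sum.union_disjoint) auto
      also have "(\<Sum>k\<in>{h} \<union> {h<..<H}. norm (C h k)) = norm (C h h) + (\<Sum>k\<in>{h<..<H}. norm (C h k))"
        by simp
      also have "(\<Sum>k<h. norm (C h k)) \<le> (\<Sum>k<h. D (h - k))"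
      proof (rule sum_mono)
        show "norm (C h k) \<le> D (h - k)" if "k \<in> {..<h}" for k using C_le'[of h k] that h by simp
      qed
      also have "(\<Sum>k<h. D (h - k)) = (\<Sum>d\<in>{1..h}. D d)"
        by (intro sum.reindex_bij_witness[of _ "\<lambda>d. h - d" "\<lambda>k. h - k"]) auto
      also have "\<dots> \<le> (\<Sum>d\<in>{1..<H}. D d)"
        using h D0 by (intro sum_mono2) auto
      also have "norm (C h h) \<le> real N"
      proof -
        have "norm (C h h) \<le> D 0" using C_le'[of h h] h by simp
        also have "\<dots> \<le> (\<Sum>n<N. norm (f n * cnj (f n)))"
          unfolding D_def by (simp add: norm_sum)
        also have "\<dots> \<le> (\<Sum>n<N. 1)"
        proof (rule sum_mono)
          show "norm (f n * cnj (f n)) \<le> 1" for n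
            using mult_mono[OF f f, of n n] by (simp add: norm_mult)
        qed
        finally show ?thesis by simp
      qed
      also have "(\<Sum>k\<in>{h<..<H}. norm (C h k)) \<le> (\<Sum>k\<in>{h<..<H}. D (k - h))"
      proof (rule sum_mono)
        show "norm (C h k) \<le> D (k - h)" if "k \<in> {h<..<H}" for k using C_le'[of h k] that by simp
      qed
      also have "(\<Sum>k\<in>{h<..<H}. D (k - h)) = (\<Sum>d\<in>{1..<H - h}. D d)"
        by (intro sum.reindex_bij_witness[of _ "\<lambda>d. d + h" "\<lambda>k. k - h"]) auto
      also have "\<dots> \<le> (\<Sum>d\<in>{1..<H}. D d)"
        using D0 by (intro sum_mono2) auto
      finally show "(\<Sum>k<H. norm (C h k)) \<le> real N + 2 * (\<Sum>d\<in>{1..<H}. D d)" by simp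
    qed
    finally show ?thesis by simp
  qed
  also have "real (card J) \<le> 2 * real N" using qH by (simp add: J_def flip: of_nat_mult)
  finally have "(real H * norm ?S)\<^sup>2 \<le> real H * (real N + 2 * (\<Sum>h\<in>{1..<H}. D h)) * (2 * real N)"
    using D0 by (simp add: mult_left_mono mult_right_mono sum_nonneg)
  then have "(real H * real H) * (norm ?S)\<^sup>2 \<le> (real H * real H) *
      (2 * real N / real H * (real N + 2 * (\<Sum>h\<in>{1..<H}. D h)))"
    using H by (simp add: power2_eq_square mult_ac)
  then show ?thesis using H unfolding D_def by (simp only: mult_le_cancel_left_pos of_nat_0_less_iff mult_pos_pos)
qed

text \<open>An Euler product: splitting off the prime \<open>p\<close> gives a truncated geometric
  series with ratio 1/sqrt p. This is the source of the product over \<open>P\<close> in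
  \<open>K3\<close>.\<close>

lemma sum_divisors_inverse_sqrt_le:
  assumes "finite P" "\<forall>p\<in>P. prime p" "m \<in> nats_over P"
  shows "(\<Sum>d | d dvd m. 1 / sqrt (real d)) \<le> (\<Prod>p\<in>P. sqrt (real p) / (sqrt (real p) - 1))"
  using assms
proof (induction P arbitrary: m rule: finite_induct)
  case empty
  then have "m = 1" by (auto simp: nats_over_def prime_factorization_empty_iff)
  then show ?case by simp
next
  case (insert p P)
  have p: "prime p" using insert by simp
  have m0: "m > 0" using insert by (simp add: nats_over_def)
  define j where "j = multiplicity p m"
  obtain m' where m': "m = p ^ j * m'" "\<not> p dvd m'"
    using multiplicity_decompose'[of m p] m0 p unfolding j_def by (metis not_prime_unit neq0_conv)
  have "m' \<in> nats_over P"
    using m0 m' nats_over_dvd[OF insert.prems(2), of m'] by (auto simp: nats_over_def prime_factors_dvd)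
  then have IH: "(\<Sum>d | d dvd m'. 1 / sqrt (real d)) \<le> (\<Prod>p\<in>P. sqrt (real p) / (sqrt (real p) - 1))"
    using insert by simp
  define r where "r = 1 / sqrt (real p)"
  have s1: "sqrt (real p) > 1" using prime_gt_1_nat[OF p] by simp
  then have r: "0 \<le> r" "r < 1" by (simp_all add: r_def)
  have m'0: "m' > 0" using m0 m' by (intro Nat.gr0I) auto
  have fin: "finite ({..j} \<times> {d. d dvd m'})" using m'0 by simp
  have "{d. d dvd m} \<subseteq> (\<lambda>(i, d). p ^ i * d) ` ({..j} \<times> {d. d dvd m'})"
  proof
    fix d assume "d \<in> {d. d dvd m}"
    then obtain u v where uv: "d = u * v" "u dvd p ^ j" "v dvd m'"
      using division_decomp[of d "p ^ j" m'] m' by auto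
    then obtain i where "i \<le> j" "u = p ^ i" using divides_primepow_nat[OF p] by auto
    then show "d \<in> (\<lambda>(i, d). p ^ i * d) ` ({..j} \<times> {d. d dvd m'})" using uv by force
  qed
  then have "(\<Sum>d | d dvd m. 1 / sqrt (real d))
      \<le> sum (\<lambda>d. 1 / sqrt (real d)) ((\<lambda>(i, d). p ^ i * d) ` ({..j} \<times> {d. d dvd m'}))"
    using fin by (intro sum_mono2) auto
  also have "\<dots> \<le> (\<Sum>z\<in>{..j} \<times> {d. d dvd m'}. (\<lambda>d. 1 / sqrt (real d)) ((\<lambda>(i, d). p ^ i * d) z))"
    using sum_image_le[OF fin, of "\<lambda>d. 1 / sqrt (real d)" "\<lambda>(i, d). p ^ i * d"] by (simp add: o_def)
  also have "\<dots> = (\<Sum>(i, d)\<in>{..j} \<times> {d. d dvd m'}. r ^ i * (1 / sqrt (real d)))"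
    by (intro sum.cong refl) (auto simp: r_def real_sqrt_mult real_sqrt_power power_one_over power_inverse divide_inverse)
  also have "\<dots> = (\<Sum>i\<le>j. r ^ i) * (\<Sum>d | d dvd m'. 1 / sqrt (real d))"
    by (simp add: sum_product sum.cartesian_product)
  also have "\<dots> \<le> 1 / (1 - r) * (\<Prod>p\<in>P. sqrt (real p) / (sqrt (real p) - 1))"
  proof (intro mult_mono IH sum_nonneg)
    have "(\<Sum>i\<le>j. r ^ i) = (1 - r ^ Suc j) / (1 - r)"
      using r by (simp add: sum_gp0)
    also have "\<dots> \<le> 1 / (1 - r)" using r by (intro divide_right_mono) auto
    finally show "(\<Sum>i\<le>j. r ^ i) \<le> 1 / (1 - r)" .
  qed (use r in auto)
  also have "1 / (1 - r) = sqrt (real p) / (sqrt (real p) - 1)"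
    using s1 by (simp add: r_def field_simps)
  finally show ?case using insert by simp
qed

text \<open>Replace sqrt(gcd h m) by the sum of sqrt d over all common divisors d and sum over
  \<open>h\<close> first: at most H/d values of \<open>h\<close> are multiples of d.\<close>

lemma sum_sqrt_gcd_le:
  assumes "finite P" "\<forall>p\<in>P. prime p" "m \<in> nats_over P"
  shows "(\<Sum>h\<in>{1..<H}. sqrt (real (gcd h m)))
    \<le> real H * (\<Prod>p\<in>P. sqrt (real p) / (sqrt (real p) - 1))"
proof -
  have m0: "m > 0" using assms by (simp add: nats_over_def)
  have fin: "finite {d. d dvd m}" using m0 by simp
  have "(\<Sum>h\<in>{1..<H}. sqrt (real (gcd h m)))
      \<le> (\<Sum>h\<in>{1..<H}. \<Sum>d | d dvd m. if d dvd h then sqrt (real d) else 0)"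
  proof (rule sum_mono)
    fix h
    have "(\<Sum>d\<in>{gcd h m}. if d dvd h then sqrt (real d) else 0)
        \<le> (\<Sum>d | d dvd m. if d dvd h then sqrt (real d) else 0)"
      using fin by (intro sum_mono2) auto
    then show "sqrt (real (gcd h m)) \<le> (\<Sum>d | d dvd m. if d dvd h then sqrt (real d) else 0)" by simp
  qed
  also have "\<dots> = (\<Sum>d | d dvd m. \<Sum>h\<in>{1..<H}. if d dvd h then sqrt (real d) else 0)"
    by (rule sum.swap)
  also have "\<dots> \<le> (\<Sum>d | d dvd m. real H * (1 / sqrt (real d)))"
  proof (rule sum_mono)
    fix d assume "d \<in> {d. d dvd m}"
    then have d: "d > 0" using m0 dvd_pos_nat by blast
    have "card {h\<in>{1..<H}. d dvd h} \<le> card {1..H div d}"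
    proof (rule card_inj_on_le)
      show "inj_on (\<lambda>h. h div d) {h\<in>{1..<H}. d dvd h}" by (auto intro!: inj_onI)
      show "(\<lambda>h. h div d) ` {h\<in>{1..<H}. d dvd h} \<subseteq> {1..H div d}"
        using d by (auto simp: div_le_mono dvd_imp_le div_greater_zero_iff Suc_le_eq)
    qed simp
    then have "real (card {h\<in>{1..<H}. d dvd h}) \<le> real (H div d)" by simp
    also have "\<dots> \<le> real H / real d" by (rule of_nat_div_le_of_nat)
    finally have "real (card {h\<in>{1..<H}. d dvd h}) * sqrt (real d) \<le> real H / real d * sqrt (real d)"
      by (rule mult_right_mono) simp
    also have "\<dots> = real H * (1 / sqrt (real d))"
      using d by (simp add: real_div_sqrt field_simps)
    also have "real (card {h\<in>{1..<H}. d dvd h}) * sqrt (real d)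
        = (\<Sum>h\<in>{1..<H}. if d dvd h then sqrt (real d) else 0)"
      by (subst sum.inter_filter[symmetric]) auto
    finally show "(\<Sum>h\<in>{1..<H}. if d dvd h then sqrt (real d) else 0) \<le> real H * (1 / sqrt (real d))" .
  qed
  also have "\<dots> = real H * (\<Sum>d | d dvd m. 1 / sqrt (real d))" by (simp add: sum_distrib_left)
  also have "\<dots> \<le> real H * (\<Prod>p\<in>P. sqrt (real p) / (sqrt (real p) - 1))"
    by (intro mult_left_mono sum_divisors_inverse_sqrt_le assms) simp
  finally show ?thesis .
qed

text \<open>The phases differ by a b^n (b^l - 1)/m, and cancelling \<open>g\<close> leaves a
  fraction with the denominator m/g. The correlation is again a sum of the original type, so the
  induction can proceed.\<close>

lemma norm_shifted_correlation:
  fixes b m l n0 :: nat and a :: int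
  assumes m: "m > 0" and b: "b > 0"
  defines "g \<equiv> gcd (b ^ l - 1) m"
  shows "norm (\<Sum>n<K. unit_exp (of_int (a * int b ^ (n + l)) / real m)
      * cnj (unit_exp (of_int (a * int b ^ n) / real m)))
    = norm (exp_sum b (m div g) (a * int ((b ^ l - 1) div g)) K)"
proof -
  have g0: "g > 0" using m by (simp add: g_def)
  define D where "D = (b ^ l - 1) div g"
  define m' where "m' = m div g"
  have D: "b ^ l - 1 = D * g" and m': "m = m' * g" by (simp_all add: D_def m'_def g_def)
  have bl: "int b ^ l = 1 + int D * int g"
  proof -
    have "b ^ l = 1 + D * g" using D b by (metis One_nat_def Suc_leI le_add_diff_inverse zero_less_power)
    then show ?thesis by (metis of_nat_1 of_nat_add of_nat_mult of_nat_power)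
  qed
  have "unit_exp (of_int (a * int b ^ (n + l)) / real m) * cnj (unit_exp (of_int (a * int b ^ n) / real m))
      = unit_exp (of_int (a * int D * int b ^ n) / real m')" for n
  proof -
    have "a * int b ^ (n + l) - a * int b ^ n = (a * int D * int b ^ n) * int g"
      by (simp add: power_add bl algebra_simps)
    then have "(of_int (a * int b ^ (n + l)) - of_int (a * int b ^ n) :: real)
        = of_int (a * int D * int b ^ n) * real g"
      by (metis of_int_diff of_int_mult of_int_of_nat_eq)
    then have "of_int (a * int b ^ (n + l)) / real m + - (of_int (a * int b ^ n) / real m)
        = of_int (a * int D * int b ^ n) / real m'"
      using g0 by (simp add: m' diff_divide_distrib[symmetric] del: of_int_mult of_int_power)
    then show ?thesis by (simp only: cnj_unit_exp unit_exp_add[symmetric])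
  qed
  then show ?thesis unfolding exp_sum_def D_def m'_def by (simp only:)
qed

text \<open>The shape that differencing preserves. It is uniform in the modulus and the numerator
  because one step meets many divisors of \<open>m\<close> and many numerators; opposite powers of
  \<open>m\<close> in the two terms match the two-sided control of the new modulus.\<close>

definition exp_sum_bound ::
    "nat set \<Rightarrow> nat \<Rightarrow> real \<Rightarrow> real \<Rightarrow> real \<Rightarrow> real \<Rightarrow> real \<Rightarrow> real \<Rightarrow> bool" where
  "exp_sum_bound P b A B \<alpha> \<beta> \<gamma> l \<longleftrightarrow> (\<forall>m a N. m \<in> nats_over P \<longrightarrow> coprime m b \<longrightarrow> coprime a (int m) \<longrightarrow> N \<ge> 1 \<longrightarrow>
     norm (exp_sum b m a N) \<le> (A * real m powr \<alpha> * real N powr (1 - \<beta>)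
       + B * real m powr (- \<alpha>) * real N powr (1 + \<gamma>)) * (1 + ln (real m)) powr l)"

lemma norm_exp_sum_le_N: "norm (exp_sum b m a N) \<le> real N"
  unfolding exp_sum_def by (rule order_trans[OF norm_sum]) simp

text \<open>With x = b^\<tau>, \<open>m\<close> divides x^T - 1, so \<open>m\<close> divides (x - 1)
  T. The order \<open>T\<close> is therefore at least m/x, and the full periods contribute at most x
  N / sqrt m.\<close>

lemma exp_sum_bound_0:
  assumes P: "finite P" "\<forall>p\<in>P. prime p" and b: "b > 1"
    and A: "A \<ge> 3" and B: "B \<ge> real b ^ period_exp P"
  shows "exp_sum_bound P b A B (1/2) 1 0 1"
  unfolding exp_sum_bound_def
proof (intro allI impI)
  fix m a N
  assume mP: "m \<in> nats_over P" "coprime m b" and a: "coprime a (int m)" and "N \<ge> (1::nat)"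
  have m0: "m > 0" using mP by (simp add: nats_over_def)
  have B0: "0 \<le> B" using B by (rule order_trans[rotated]) simp
  define T where "T = ord m b"
  interpret power_residues b m T
    by unfold_locales
       (use mP m0 ord[of b m] ord_minimal[of _ m b] in \<open>auto simp: T_def\<close>)
  define x where "x = b ^ period_exp P"
  have pe: "period_exp P > 0" using P by (intro period_exp_pos)
  have x1: "x > 1" unfolding x_def using b pe by (rule one_less_power)
  have "[(b ^ T) ^ period_exp P = 1 ^ period_exp P] (mod m)" by (rule cong_pow[OF cong_T])
  then have "[x ^ T = 1] (mod m)" by (simp add: x_def mult.commute flip: power_mult)
  then have "m dvd x ^ T - 1" using x1 by (simp add: cong_altdef_nat)
  then have "gcd (x ^ T - 1) m = m" by simp
  then have "m dvd (x - 1) * T"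
    using gcd_power_diff_1_dvd[OF P(1) mP b T pe] unfolding x_def by simp
  then have "m \<le> (x - 1) * T" using x1 T by (intro dvd_imp_le) auto
  also have "\<dots> \<le> x * T" by (intro mult_right_mono) auto
  finally have "real m \<le> real x * real T" by (metis of_nat_le_iff of_nat_mult)
  then have "1 / real T \<le> real x / real m" using T m0 by (simp add: field_simps)
  then have "real N * (1 / real T) * sqrt (real m) \<le> real N * (real x / real m) * sqrt (real m)"
    by (intro mult_right_mono mult_left_mono) simp_all
  also have "\<dots> = real x * real N * (sqrt (real m) / real m)" by simp
  also have "\<dots> = real x * real N * (real m powr (- (1/2)))"
    by (simp only: sqrt_divide_self_eq[OF of_nat_0_le_iff] powr_minus powr_half_sqrt[OF of_nat_0_le_iff])
  also have "\<dots> \<le> B * real N * (real m powr (- (1/2))) * (1 + ln (real m))"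
  proof -
    have "real x * real N * (real m powr (- (1/2))) \<le> B * real N * (real m powr (- (1/2)))"
      using B by (intro mult_right_mono) (simp_all add: x_def)
    moreover have "B * real N * (real m powr (- (1/2))) * 1 \<le> B * real N * (real m powr (- (1/2))) * (1 + ln (real m))"
      using m0 B0 by (intro mult_left_mono mult_nonneg_nonneg) simp_all
    ultimately show ?thesis unfolding mult_1_right by (rule order_trans)
  qed
  finally have 1: "real N / real T * sqrt (real m) \<le> B * real N * (real m powr (- (1/2))) * (1 + ln (real m))"
    by simp
  have "sqrt (real m) * (3 * (1 + ln (real m))) \<le> sqrt (real m) * (A * (1 + ln (real m)))"
    using A m0 by (intro mult_left_mono mult_right_mono) auto
  then have "norm (exp_sum b m a N) \<le> A * real m powr (1/2) * (1 + ln (real m))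
      + B * real N * (real m powr (- (1/2))) * (1 + ln (real m))"
  proof -
    have "sqrt (real m) * (A * (1 + ln (real m))) = A * real m powr (1/2) * (1 + ln (real m))"
      by (simp add: powr_half_sqrt)
    then show ?thesis using norm_exp_sum_le[OF a, of N] 1 \<open>_ \<le> sqrt (real m) * (A * (1 + ln (real m)))\<close>
      by linarith
  qed
  also have "\<dots> = (A * real m powr (1/2) * real N powr (1 - 1)
      + B * real m powr (- (1/2)) * real N powr (1 + 0)) * (1 + ln (real m)) powr 1"
  proof -
    have "A * u * L + B * w * v * L = (A * u * 1 + B * v * w) * L" for u v w L :: real
      by (simp add: algebra_simps)
    moreover have "real N powr (1 - 1) = 1" "real N powr (1 + 0) = real N"
        "(1 + ln (real m)) powr 1 = 1 + ln (real m)"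
      using \<open>N \<ge> 1\<close> m0 by simp_all
    ultimately show ?thesis by (simp only:)
  qed
  finally show "norm (exp_sum b m a N) \<le> (A * real m powr (1/2) * real N powr (1 - 1)
      + B * real m powr (- (1/2)) * real N powr (1 + 0)) * (1 + ln (real m)) powr 1" .
qed

text \<open>The left side collects the diagonal and the correlations of one differencing step, up to
  common factors. Its domination by the squares is what lets \<open>A\<close> and \<open>B\<close>
  survive the step unchanged.\<close>

lemma square_sum_absorb:
  fixes A B Q E f g :: real
  assumes Q: "Q \<ge> 1" and A: "A \<ge> 6 * Q" and B: "B \<ge> 4 * E" and "0 \<le> E"
  shows "4 * Q * f\<^sup>2 + 4 * (A * (Q * f\<^sup>2) + B * E * g\<^sup>2) \<le> (A * f)\<^sup>2 + (B * g)\<^sup>2"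
proof -
  have "Q \<le> Q * Q" using Q mult_left_mono[of 1 Q Q] by simp
  moreover have "6 * (A * Q) \<le> A * A" using mult_left_mono[OF A, of A] A Q by simp
  moreover have "6 * (Q * Q) \<le> A * Q" using mult_right_mono[OF A, of Q] Q by simp
  ultimately have "4 * Q + 4 * A * Q \<le> A * A" unfolding mult.assoc using Q by linarith
  then have "(4 * Q + 4 * A * Q) * f\<^sup>2 \<le> A * A * f\<^sup>2" by (rule mult_right_mono) simp
  moreover have "B * (4 * E) \<le> B * B" using assms by (intro mult_left_mono) auto
  then have "B * (4 * E) * g\<^sup>2 \<le> B * B * g\<^sup>2" by (rule mult_right_mono) simp
  ultimately show ?thesis by (simp add: power_mult_distrib power2_eq_square algebra_simps)
qed

text \<open>The exponent \<open>lam\<close> is free below its optimal value \<open>1 - 2\<beta>'\<close>; it fixes the size \<open>m^(2\<alpha>') N^lam\<close> of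
  the divisor \<open>q\<close> of \<open>m\<close> that enters the shifts.\<close>
lemma exp_sum_bound_step:
  fixes \<alpha> \<beta> \<gamma> l lam A B :: real
  assumes P: "finite P" "\<forall>p\<in>P. prime p" and b: "b > 1"
    and bound: "exp_sum_bound P b A B \<alpha> \<beta> \<gamma> l"
    and \<alpha>: "0 < \<alpha>" "\<alpha> \<le> 1/2" and \<beta>: "\<beta> \<le> 1" and \<gamma>: "0 \<le> \<gamma>" and l: "0 \<le> l"
    and lam: "0 \<le> lam" "lam \<le> 1 - 2 * \<beta>'"
    and \<alpha>': "\<alpha>' = \<alpha> / (2 * (1 + \<alpha>))" and \<beta>': "\<beta>' = (\<beta> + \<alpha> * lam) / 2"
    and \<gamma>': "\<gamma>' = (\<gamma> + \<alpha> * lam) / 2"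
    and A: "A \<ge> 6 * real (\<Prod>P)"
    and B: "B \<ge> 4 * (sqrt (real b ^ period_exp P) * (\<Prod>p\<in>P. sqrt (real p) / (sqrt (real p) - 1)))"
      "B \<ge> 1"
  shows "exp_sum_bound P b A B \<alpha>' \<beta>' \<gamma>' (l / 2)"
  unfolding exp_sum_bound_def
proof (intro allI impI)
  fix m a N
  assume m: "m \<in> nats_over P" "coprime m b" and a: "coprime a (int m)" and N: "N \<ge> (1::nat)"
  have m0: "m > 0" using m by (simp add: nats_over_def)
  define Q where "Q = real (\<Prod>P)"
  have pe: "period_exp P > 0" using P by (intro period_exp_pos)
  have Q_pe: "real (period_exp P) \<le> Q" unfolding Q_def using period_exp_le of_nat_le_iff by blast
  then have Q1: "Q \<ge> 1" using pe by simp
  have A1: "A \<ge> 1" "A \<ge> 6 * Q" using A Q1 unfolding Q_def by simp_all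
  define x where "x = b ^ period_exp P"
  have x1: "x > 1" unfolding x_def using b pe by (rule one_less_power)
  define prd where "prd = (\<Prod>p\<in>P. sqrt (real p) / (sqrt (real p) - 1))"
  have prod0: "0 \<le> prd" unfolding prd_def
  proof (intro prod_nonneg)
    fix p assume "p \<in> P"
    then have "1 \<le> real p" using P(2) prime_gt_1_nat[of p] by simp
    then show "0 \<le> sqrt (real p) / (sqrt (real p) - 1)" by simp
  qed
  define E where "E = sqrt (real x) * prd"
  have E0: "0 \<le> E" using prod0 by (simp add: E_def)
  have BE: "B \<ge> 4 * E" using B(1) by (simp add: E_def x_def prd_def)
  define M where "M = real m"
  have M1: "M \<ge> 1" using m0 by (simp add: M_def)
  define n where "n = real N"
  have n1: "n \<ge> 1" using N by (simp add: n_def)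
  \<comment> \<open>\<open>y\<close> is the target size of the divisor; \<open>F\<close> and
    \<open>G\<close> are the two terms of the goal divided by \<open>N\<close>, stripped of
    constants and logarithm.\<close>
  define y where "y = M powr (2 * \<alpha>') * n powr lam"
  define F where "F = M powr \<alpha>' * n powr (- \<beta>')"
  define G where "G = M powr (- \<alpha>') * n powr \<gamma>'"
  define \<Lambda> where "\<Lambda> = (1 + ln M) powr (l / 2)"
  have FG0: "F > 0" "G > 0" using M1 n1 by (simp_all add: F_def G_def)
  have \<Lambda>1: "\<Lambda> \<ge> 1" unfolding \<Lambda>_def using M1 l by (intro ge_one_powr_ge_zero) auto
  have \<Lambda>sq: "\<Lambda>\<^sup>2 = (1 + ln M) powr l" using M1 by (simp add: \<Lambda>_def power2_eq_square flip: powr_add)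
  have \<alpha>'0: "\<alpha>' > 0" using \<alpha> by (simp add: \<alpha>')
  \<comment> \<open>This equation determines \<alpha>': the powers of \<open>m\<close> in
    \<open>(M / y) powr \<alpha>\<close> and in \<open>y\<close> agree, so that both are matched by
    \<open>F\<^sup>2\<close>.\<close>
  have \<alpha>'_eq: "\<alpha> - 2 * \<alpha>' * \<alpha> = 2 * \<alpha>'" using \<alpha> by (simp add: \<alpha>' field_simps)
  have y1: "y \<ge> 1" unfolding y_def
    using mult_mono[OF ge_one_powr_ge_zero[OF M1] ge_one_powr_ge_zero[OF n1 lam(1)], of "2 * \<alpha>'"] \<alpha>'0 by simp
  have My: "M / y = M powr (1 - 2 * \<alpha>') * n powr (- lam)"
    using M1 by (simp add: y_def powr_diff powr_minus field_simps)
  have powr_My: "(M / y) powr r = M powr ((1 - 2 * \<alpha>') * r) * n powr (- lam * r)" for r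
    unfolding My by (simp only: powr_mult powr_powr)
  have sqF: "(M / y) powr \<alpha> * n powr (- \<beta>) = F\<^sup>2"
  proof -
    have "(M / y) powr \<alpha> * n powr (- \<beta>) = M powr (\<alpha> - 2 * \<alpha>' * \<alpha>) * n powr (- lam * \<alpha> + - \<beta>)"
      by (simp only: powr_My mult.assoc powr_add left_diff_distrib mult_1)
    also have "- lam * \<alpha> + - \<beta> = - \<beta>' + - \<beta>'" by (simp add: \<beta>' field_simps)
    also have "\<alpha> - 2 * \<alpha>' * \<alpha> = \<alpha>' + \<alpha>'" using \<alpha>'_eq by simp
    finally show ?thesis unfolding powr_add by (simp add: F_def power2_eq_square mult_ac)
  qed
  have sqG: "(M / y) powr (- \<alpha>) * n powr \<gamma> = G\<^sup>2"
  proof -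
    have "(M / y) powr (- \<alpha>) * n powr \<gamma> = M powr ((1 - 2 * \<alpha>') * - \<alpha>) * n powr (- lam * - \<alpha> + \<gamma>)"
      by (simp only: powr_My mult.assoc powr_add)
    also have "- lam * - \<alpha> + \<gamma> = \<gamma>' + \<gamma>'" by (simp add: \<gamma>' field_simps)
    also have "(1 - 2 * \<alpha>') * - \<alpha> = - \<alpha>' + - \<alpha>'" using \<alpha>'_eq by (simp add: algebra_simps)
    finally show ?thesis unfolding powr_add by (simp add: G_def power2_eq_square mult_ac)
  qed
  \<comment> \<open>The diagonal contribution is of size y/n; here the upper bound on
    \<open>lam\<close> enters.\<close>
  have y_n: "y / n \<le> F\<^sup>2"
  proof -
    have "y / n = M powr (2 * \<alpha>') * n powr (lam - 1)" using n1 by (simp add: y_def powr_diff)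
    also have "\<dots> \<le> M powr (2 * \<alpha>') * n powr (- 2 * \<beta>')"
      using n1 lam by (intro mult_left_mono powr_mono) auto
    also have "2 * \<alpha>' = \<alpha>' + \<alpha>'" by simp
    also have "- 2 * \<beta>' = - \<beta>' + - \<beta>'" by simp
    also have "M powr (\<alpha>' + \<alpha>') * n powr (- \<beta>' + - \<beta>') = F\<^sup>2"
      unfolding powr_add by (simp only: F_def power2_eq_square mult_ac)
    finally show ?thesis .
  qed
  \<comment> \<open>Disposes of the ranges where no shift is available: \<open>y\<close> beyond
    \<open>m\<close>, or \<open>q\<close> beyond \<open>N\<close>.\<close>
  have trivial: "norm (exp_sum b m a N) \<le> n * (A * F + B * G) * \<Lambda>" if "A * F + B * G \<ge> 1"
  proof -
    have "norm (exp_sum b m a N) \<le> n * 1 * 1" using norm_exp_sum_le_N by (simp add: n_def)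
    also have "\<dots> \<le> n * (A * F + B * G) * \<Lambda>"
      using that \<Lambda>1 n1 by (intro mult_mono) auto
    finally show ?thesis .
  qed
  have "norm (exp_sum b m a N) \<le> n * (A * F + B * G) * \<Lambda>"
  proof (cases "y \<le> M")
    case False
    \<comment> \<open>The left-hand factor is at least 1 since M < y, the other since \<gamma> \<ge>
      0. This sign condition later limits how far \<open>c k\<close> may be lowered.\<close>
    have "1 * 1 \<le> (M / y) powr (- \<alpha>) * n powr \<gamma>"
    proof (intro mult_mono)
      have "(M / y) powr \<alpha> \<le> 1" using False M1 \<alpha> y1 by (intro powr_le1) auto
      then show "1 \<le> (M / y) powr (- \<alpha>)" using M1 y1 by (simp add: powr_minus one_le_inverse_iff)
    qed (use n1 \<gamma> in \<open>auto intro: ge_one_powr_ge_zero\<close>)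
    then have "1 \<le> G" using FG0 unfolding sqG by (simp add: power2_nonneg_ge_1_iff)
    then have "1 * 1 \<le> B * G" using B by (intro mult_mono) auto
    moreover have "0 \<le> A * F" using A1 FG0 by (intro mult_nonneg_nonneg) linarith+
    ultimately show ?thesis using trivial by linarith
  next
    case True
    then obtain q0 where q0: "q0 dvd m" "real q0 \<le> y" "y \<le> Q * real q0"
      using exists_divisor_near[OF P m(1) y1] unfolding M_def Q_def by blast
    have q00: "q0 > 0" using q0(1) m0 dvd_pos_nat by blast
    define q where "q = period_exp P * q0"
    have q: "q > 0" using pe q00 by (simp add: q_def)
    have "real q \<le> Q * y"
      unfolding q_def of_nat_mult using Q_pe q0 Q1 by (intro mult_mono) auto
    then have qn: "real q / n \<le> Q * F\<^sup>2"
      using mult_left_mono[OF y_n, of Q] divide_right_mono[of "real q" "Q * y" n] Q1 n1 by simp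
    show ?thesis
    proof (cases "q \<le> N")
      case False
      then have "1 \<le> real q / n" using n1 by (simp add: n_def)
      then have "1 \<le> Q * F\<^sup>2" using qn by simp
      also have "\<dots> \<le> A * F\<^sup>2" using A1 Q1 by (intro mult_right_mono) auto
      also have "\<dots> \<le> A * (A * F\<^sup>2)" using A1 mult_right_mono[of 1 A "A * F\<^sup>2"] by simp
      finally have "1 \<le> (A * F)\<^sup>2" by (simp add: power2_eq_square mult_ac)
      then have "1 \<le> A * F" using A1 FG0 by (simp add: power2_nonneg_ge_1_iff)
      moreover have "0 \<le> B * G" using B(2) FG0 by (intro mult_nonneg_nonneg) linarith+
      ultimately show ?thesis using trivial by linarith
    next
      case qN: True
      \<comment> \<open>The longest range of shifts with q H \<le> N; as q \<le> N, rounding down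
        costs at most a factor 2.\<close>
      define H where "H = N div q"
      have H: "H > 0" using qN q by (simp add: H_def div_greater_zero_iff)
      have qH: "q * H \<le> N" by (simp add: H_def)
      have "N < q * (H + 1)" using dividend_less_times_div[OF q, of N] by (simp add: H_def)
      also have "\<dots> \<le> q * (2 * H)" using H by (intro mult_left_mono) auto
      finally have "n \<le> real (q * (2 * H))" unfolding n_def by (simp only: of_nat_le_iff less_imp_le)
      then have Hinv: "2 / real H \<le> 4 * (real q / n)" using H n1 by (simp add: field_simps)
      let ?f = "\<lambda>i. unit_exp (of_int (a * int b ^ i) / real m)"
      let ?D = "\<lambda>h. norm (\<Sum>i<N - q * h. ?f (i + q * h) * cnj (?f i))"
      have D_le: "?D h \<le> (A * (Q * F\<^sup>2) * n + B * sqrt (real x) * G\<^sup>2 * n * sqrt (real (gcd h m))) * \<Lambda>\<^sup>2"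
        if h: "h \<in> {1..<H}" for h
      proof -
        define g where "g = gcd (b ^ (q * h) - 1) m"
        have g0: "g > 0" using m0 by (simp add: g_def)
        define m' where "m' = m div g"
        have m': "m = m' * g" by (simp add: m'_def g_def)
        have m'0: "m' > 0" using m0 m' by (intro Nat.gr0I) auto
        have bx: "b ^ (q * h) = x ^ (q0 * h)" by (simp add: x_def q_def mult.assoc flip: power_mult)
        have "q0 dvd x ^ q0 - 1"
          using dvd_power_self_diff_1[OF P(1) m _ q0(1)] b unfolding x_def by simp
        also have "\<dots> dvd (x ^ q0) ^ h - 1"
        proof -
          have "int (x ^ q0) - 1 dvd int (x ^ q0) ^ h - 1" by (metis power_diff_1_eq dvd_triv_left)
          moreover have "int (x ^ q0 - 1) = int (x ^ q0) - 1" "int ((x ^ q0) ^ h - 1) = int (x ^ q0) ^ h - 1"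
            using x1 by (simp_all add: of_nat_diff)
          ultimately show ?thesis by (metis int_dvd_int_iff)
        qed
        finally have "q0 dvd g" unfolding g_def bx using q0(1) by (simp add: power_mult)
        then have g_ge: "q0 \<le> g" using g0 by (rule dvd_imp_le)
        \<comment> \<open>Both bounds on \<open>g\<close> matter: the lower one keeps the new
          modulus m/g small for the first term, the upper one keeps it large for the term with the
          negative power. The loss gcd(h, m) is averaged over \<open>h\<close> afterwards.\<close>
        have g_le: "g \<le> x * q0 * gcd h m"
        proof -
          have "g dvd (x - 1) * (q0 * h)"
            unfolding g_def bx using gcd_power_diff_1_dvd[OF P(1) m b _ pe, of "q0 * h"] q00 h
            by (simp add: x_def)
          then have "g dvd ((x - 1) * q0) * h" by (simp add: mult.assoc)
          moreover have "g dvd ((x - 1) * q0) * m" by (simp add: g_def)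
          ultimately have "g dvd gcd (((x - 1) * q0) * h) (((x - 1) * q0) * m)" by (rule gcd_greatest)
          also have "\<dots> = (x - 1) * q0 * gcd h m" by (simp add: gcd_mult_distrib_nat)
          finally have "g \<le> (x - 1) * q0 * gcd h m" using x1 q00 m0 by (intro dvd_imp_le) auto
          also have "\<dots> \<le> x * q0 * gcd h m" by (intro mult_right_mono) auto
          finally show ?thesis .
        qed
        define K where "K = N - q * h"
        have "q * h < q * H" using h q by simp
        then have K: "1 \<le> K" "K \<le> N" using qH unfolding K_def by linarith+
        have "?D h = norm (exp_sum b m' (a * int ((b ^ (q * h) - 1) div g)) K)"
          unfolding K_def m'_def g_def by (rule norm_shifted_correlation[OF m0]) (use b in simp)
        also have "\<dots> \<le> (A * real m' powr \<alpha> * real K powr (1 - \<beta>)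
            + B * real m' powr (- \<alpha>) * real K powr (1 + \<gamma>)) * (1 + ln (real m')) powr l"
        proof -
          have "m' dvd m" using m' by simp
          have "coprime ((b ^ (q * h) - 1) div g) m'"
            unfolding g_def m'_def using m0 by (intro div_gcd_coprime) auto
          moreover have "coprime a (int m')"
            using a \<open>m' dvd m\<close> by (metis coprime_divisors dvd_refl int_dvd_int_iff)
          ultimately have "coprime (a * int ((b ^ (q * h) - 1) div g)) (int m')" by simp
          moreover have "m' \<in> nats_over P" using nats_over_dvd[OF m(1) \<open>m' dvd m\<close>] .
          moreover have "coprime m' b" using m(2) \<open>m' dvd m\<close> by (metis coprime_divisors dvd_refl)
          ultimately show ?thesis using bound K(1) unfolding exp_sum_bound_def by blast
        qed
        also have "\<dots> \<le> (A * (Q * F\<^sup>2) * n + B * sqrt (real x) * G\<^sup>2 * n * sqrt (real (gcd h m))) * \<Lambda>\<^sup>2"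
        proof -
          have y0: "y > 0" using y1 by simp
          have Mg: "real m' = M / real g" using g0 m' by (simp add: M_def)
          have "real m' \<le> Q * (M / y)"
          proof -
            have "y \<le> Q * real g" using q0(3) g_ge Q1 by (smt (verit) mult_left_mono of_nat_le_iff)
            then have "M * y \<le> M * (Q * real g)" using M1 by (intro mult_left_mono) auto
            then show ?thesis using y0 g0 unfolding Mg by (simp add: field_simps)
          qed
          then have "real m' powr \<alpha> \<le> (Q * (M / y)) powr \<alpha>" using \<alpha> by (intro powr_mono2) auto
          also have "\<dots> = Q powr \<alpha> * (M / y) powr \<alpha>" using Q1 M1 y0 by (intro powr_mult)
          also have "\<dots> \<le> Q powr 1 * (M / y) powr \<alpha>" using Q1 \<alpha> by (intro mult_right_mono powr_mono) auto
          finally have 1: "real m' powr \<alpha> \<le> Q * (M / y) powr \<alpha>" using Q1 by simp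
          have "real g \<le> real x * y * real (gcd h m)"
          proof -
            have "real g \<le> real x * real q0 * real (gcd h m)" using g_le by (metis of_nat_le_iff of_nat_mult)
            also have "\<dots> \<le> real x * y * real (gcd h m)" using q0(2) by (intro mult_right_mono mult_left_mono) auto
            finally show ?thesis .
          qed
          then have "M / y \<le> real m' * (real x * real (gcd h m))"
            unfolding Mg using y0 g0 M1 by (simp add: field_simps)
          then have "(M / y) powr \<alpha> \<le> (real m' * (real x * real (gcd h m))) powr \<alpha>"
            using \<alpha> M1 y0 by (intro powr_mono2) auto
          also have "\<dots> = real m' powr \<alpha> * (real x * real (gcd h m)) powr \<alpha>" by (intro powr_mult)
          \<comment> \<open>Raising the exponent from \<alpha> to 1/2 makes the same average of
            sqrt(gcd h m) serve every \<open>k\<close>.\<close>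
          also have "\<dots> \<le> real m' powr \<alpha> * (real x * real (gcd h m)) powr (1/2)"
          proof (intro mult_left_mono powr_mono)
            have "1 * 1 \<le> real x * real (gcd h m)" using x1 m0
              by (intro mult_mono) (auto simp: Suc_le_eq)
            then show "1 \<le> real x * real (gcd h m)" by simp
          qed (use \<alpha> in auto)
          also have "(real x * real (gcd h m)) powr (1/2) = sqrt (real x) * sqrt (real (gcd h m))"
            by (simp add: powr_half_sqrt real_sqrt_mult)
          finally have 2: "real m' powr (- \<alpha>) \<le> sqrt (real x) * sqrt (real (gcd h m)) * (M / y) powr (- \<alpha>)"
            using m'0 M1 y0 by (simp add: powr_minus field_simps)
          have 3: "real K powr (1 - \<beta>) \<le> n powr (1 - \<beta>)" "real K powr (1 + \<gamma>) \<le> n powr (1 + \<gamma>)"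
            using K \<beta> \<gamma> by (auto simp: n_def intro!: powr_mono2)
          have "m' \<le> m" using m' g0 by simp
          then have "ln (real m') \<le> ln M" "0 \<le> ln (real m')" using m'0 m0 by (simp_all add: M_def)
          then have 4: "(1 + ln (real m')) powr l \<le> \<Lambda>\<^sup>2" unfolding \<Lambda>sq using l by (intro powr_mono2) auto
          have "A * real m' powr \<alpha> * real K powr (1 - \<beta>) \<le> A * (Q * (M / y) powr \<alpha>) * n powr (1 - \<beta>)"
            using A1 1 3(1) Q1 by (intro mult_mono mult_left_mono) auto
          also have "\<dots> = A * (Q * F\<^sup>2) * n"
          proof -
            have "n powr (1 - \<beta>) = n * n powr (- \<beta>)"
              using n1 by (simp add: powr_diff powr_minus divide_inverse)
            then show ?thesis unfolding sqF[symmetric] by (simp only: mult_ac)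
          qed
          finally have 5: "A * real m' powr \<alpha> * real K powr (1 - \<beta>) \<le> A * (Q * F\<^sup>2) * n" .
          have "B * real m' powr (- \<alpha>) * real K powr (1 + \<gamma>)
              \<le> B * (sqrt (real x) * sqrt (real (gcd h m)) * (M / y) powr (- \<alpha>)) * n powr (1 + \<gamma>)"
            using B 2 3(2) by (intro mult_mono mult_left_mono) auto
          also have "\<dots> = B * sqrt (real x) * G\<^sup>2 * n * sqrt (real (gcd h m))"
            unfolding sqG[symmetric] using n1 by (simp add: powr_add mult_ac)
          finally have 6: "B * real m' powr (- \<alpha>) * real K powr (1 + \<gamma>)
              \<le> B * sqrt (real x) * G\<^sup>2 * n * sqrt (real (gcd h m))" .
          show ?thesis
            by (rule mult_mono[OF add_mono[OF 5 6] 4]) (use A1 B(2) Q1 n1 in auto)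
        qed
        finally show ?thesis .
      qed
      have "(\<Sum>h\<in>{1..<H}. ?D h)
          \<le> (\<Sum>h\<in>{1..<H}. (A * (Q * F\<^sup>2) * n + B * sqrt (real x) * G\<^sup>2 * n * sqrt (real (gcd h m))) * \<Lambda>\<^sup>2)"
        by (intro sum_mono D_le)
      also have "\<dots> = (real (H - 1) * (A * (Q * F\<^sup>2) * n)
          + B * sqrt (real x) * G\<^sup>2 * n * (\<Sum>h\<in>{1..<H}. sqrt (real (gcd h m)))) * \<Lambda>\<^sup>2"
        by (simp add: sum.distrib flip: sum_distrib_right sum_distrib_left)
      also have "\<dots> \<le> (real H * (A * (Q * F\<^sup>2) * n)
          + B * sqrt (real x) * G\<^sup>2 * n * (real H * prd)) * \<Lambda>\<^sup>2"
        using A1 B Q1 n1 sum_sqrt_gcd_le[OF P m(1), of H]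
        by (intro mult_right_mono add_mono mult_left_mono) (auto simp: prd_def)
      also have "\<dots> = real H * n * (A * (Q * F\<^sup>2) + B * E * G\<^sup>2) * \<Lambda>\<^sup>2"
        by (simp add: E_def algebra_simps)
      finally have sumD: "(\<Sum>h\<in>{1..<H}. ?D h) \<le> real H * n * (A * (Q * F\<^sup>2) + B * E * G\<^sup>2) * \<Lambda>\<^sup>2" .
      have "(norm (exp_sum b m a N))\<^sup>2 \<le> 2 * real N / real H * (real N + 2 * (\<Sum>h\<in>{1..<H}. ?D h))"
        unfolding exp_sum_def by (rule van_der_corput_shift[OF H qH]) simp
      also have "\<dots> \<le> 2 * n / real H * (n + 2 * (real H * n * (A * (Q * F\<^sup>2) + B * E * G\<^sup>2) * \<Lambda>\<^sup>2))"
        unfolding n_def[symmetric] using sumD n1 by (intro mult_left_mono) auto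
      also have "\<dots> = n\<^sup>2 * (2 / real H + 4 * (A * (Q * F\<^sup>2) + B * E * G\<^sup>2) * \<Lambda>\<^sup>2)"
      proof -
        have "2 * u / h * (u + 2 * (h * u * Z * w)) = u\<^sup>2 * (2 / h + 4 * Z * w)" if "h \<noteq> 0" for u h Z w :: real
          using that by (simp add: field_simps power2_eq_square)
        then show ?thesis using H by simp
      qed
      also have "\<dots> \<le> n\<^sup>2 * (4 * Q * F\<^sup>2 * \<Lambda>\<^sup>2 + 4 * (A * (Q * F\<^sup>2) + B * E * G\<^sup>2) * \<Lambda>\<^sup>2)"
      proof (intro mult_left_mono add_right_mono)
        have "2 / real H \<le> 4 * Q * F\<^sup>2 * 1" using Hinv qn by simp
        also have "\<dots> \<le> 4 * Q * F\<^sup>2 * \<Lambda>\<^sup>2"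
          using \<Lambda>1 Q1 by (intro mult_left_mono) (auto intro: one_le_power)
        finally show "2 / real H \<le> 4 * Q * F\<^sup>2 * \<Lambda>\<^sup>2" .
      qed simp
      also have "\<dots> = n\<^sup>2 * ((4 * Q * F\<^sup>2 + 4 * (A * (Q * F\<^sup>2) + B * E * G\<^sup>2)) * \<Lambda>\<^sup>2)"
        by (simp add: algebra_simps)
      also have "\<dots> \<le> n\<^sup>2 * (((A * F)\<^sup>2 + (B * G)\<^sup>2) * \<Lambda>\<^sup>2)"
        by (intro mult_left_mono mult_right_mono square_sum_absorb Q1 A1 BE E0) auto
      also have "\<dots> \<le> n\<^sup>2 * ((A * F + B * G)\<^sup>2 * \<Lambda>\<^sup>2)"
        using A1 B FG0 by (intro mult_left_mono mult_right_mono) (auto simp: power2_sum)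
      also have "\<dots> = (n * (A * F + B * G) * \<Lambda>)\<^sup>2" by (simp add: power_mult_distrib)
      finally show ?thesis
        by (rule power2_le_imp_le) (use A1 B FG0 n1 \<Lambda>1 in auto)
    qed
  qed
  also have "n * (A * F + B * G) * \<Lambda> = (A * M powr \<alpha>' * n powr (1 - \<beta>')
       + B * M powr (- \<alpha>') * n powr (1 + \<gamma>')) * (1 + ln M) powr (l / 2)"
  proof -
    have "n powr (1 - \<beta>') = n * n powr (- \<beta>')" "n powr (1 + \<gamma>') = n * n powr \<gamma>'"
      using n1 by (simp_all add: powr_add powr_diff powr_minus divide_inverse)
    then show ?thesis by (simp only: F_def G_def \<Lambda>_def) (simp only: distrib_left mult_ac)
  qed
  finally show "norm (exp_sum b m a N) \<le> (A * real m powr \<alpha>' * real N powr (1 - \<beta>')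
       + B * real m powr (- \<alpha>') * real N powr (1 + \<gamma>')) * (1 + ln (real m)) powr (l / 2)"
    by (simp add: M_def n_def)
qed

section \<open>The numerical value of the constant\<close>

text \<open>The infinite products of the terms with j < n share the tail from \<open>n\<close> on.
  Without this tail they give a finite sum with a first-order recursion in \<open>n\<close>, which
  can be evaluated.\<close>

definition c_partial :: "nat \<Rightarrow> real"
  where "c_partial n = (\<Sum>j<n. (1 + 1 / (2 ^ (j + 1) - 1)) * (\<Prod>i=j..<n. c_factor i))"

lemma c_partial_Suc:
  "c_partial (Suc n) = c_factor n * (c_partial n + (1 + 1 / (2 ^ (n + 1) - 1)))"
proof -
  have "(\<Prod>i=j..<Suc n. c_factor i) = (\<Prod>i=j..<n. c_factor i) * c_factor n" if "j \<le> n" for j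
    using that by simp
  then have "c_partial (Suc n) = (\<Sum>j<Suc n. (1 + 1 / (2 ^ (j + 1) - 1)) * (\<Prod>i=j..<n. c_factor i) * c_factor n)"
    unfolding c_partial_def by (intro sum.cong) auto
  also have "\<dots> = c_factor n * (c_partial n + (1 + 1 / (2 ^ (n + 1) - 1)))"
    unfolding c_partial_def by (simp add: sum_distrib_left algebra_simps)
  finally show ?thesis .
qed

lemma sum_c_term:
  "(\<Sum>j<n. c_term j) = (\<Prod>i. c_factor (i + n)) * c_partial n - real n"
proof -
  have eq: "(\<Prod>i. c_factor (i + j)) = (\<Prod>i. c_factor (i + n)) * (\<Prod>i=j..<n. c_factor i)" if "j \<le> n" for j
  proof -
    have "(\<Prod>i. c_factor (i + j)) = (\<Prod>i. c_factor (i + (n - j) + j)) * (\<Prod>i<n-j. c_factor (i + j))"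
      by (rule prodinf_split_initial_segment[OF convergent_prod_c_factor])
        (metis c_factor_bounds(1) less_irrefl)
    moreover have "(\<Prod>i<n-j. c_factor (i + j)) = (\<Prod>i=j..<n. c_factor i)"
      using that by (intro prod.reindex_bij_witness[of _ "\<lambda>i. i - j" "\<lambda>i. i + j"]) auto
    ultimately show ?thesis using that by (simp add: add.assoc)
  qed
  have "c_term j = (\<Prod>i. c_factor (i + n)) * ((1 + 1 / (2 ^ (j + 1) - 1)) * (\<Prod>i=j..<n. c_factor i)) - 1"
    if "j < n" for j
    unfolding c_term_def eq[OF less_imp_le[OF that]] by (simp only: mult.left_commute)
  then have "(\<Sum>j<n. c_term j) = (\<Sum>j<n. (\<Prod>i. c_factor (i + n))
      * ((1 + 1 / (2 ^ (j + 1) - 1)) * (\<Prod>i=j..<n. c_factor i)) - 1)"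
    by (intro sum.cong refl) (simp only: lessThan_iff)
  then show ?thesis by (simp only: c_partial_def sum_subtractf sum_distrib_left) simp
qed

lemma abs_c_term_le: "\<bar>c_term j\<bar> \<le> 2 * (1/2) ^ j"
proof -
  let ?p = "\<Prod>i. c_factor (i + j)" and ?q = "1 / (2 ^ (j + 1) - 1) :: real"
  have p0: "0 \<le> ?p"
    by (rule LIMSEQ_le_const[OF convergent_prod_LIMSEQ[OF convergent_prod_c_factor]])
       (auto intro!: prod_nonneg less_imp_le[OF c_factor_bounds(1)])
  have "(1::real) \<le> 2 ^ j" by simp
  then have one: "0 \<le> (2::real) ^ (j + 1) - 1" "2 ^ j \<le> (2::real) ^ (j + 1) - 1"
    unfolding power_add power_one_right by linarith+
  have "0 \<le> ?q" using one(1) by (rule divide_nonneg_nonneg[OF zero_le_one])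
  moreover have "?q \<le> (1/2) ^ j"
    using frac_le[OF _ _ _ one(2), of 1 1] by (simp add: power_one_over)
  ultimately have q: "0 \<le> ?q" "?q \<le> (1/2) ^ j" .
  have "0 \<le> ?q * ?p" using q(1) p0 by (rule mult_nonneg_nonneg)
  moreover have "?q * ?p \<le> ?q * 1"
    by (rule mult_left_mono[OF prodinf_c_factor_bounds(2) q(1)])
  moreover have "c_term j = ?p - 1 + ?q * ?p" by (simp add: c_term_def algebra_simps)
  moreover have "(0::real) \<le> (1/2) ^ j" by simp
  ultimately show ?thesis using prodinf_c_factor_bounds[of j] q by linarith
qed

lemma c_const_tail: "\<bar>c_const - (\<Sum>j<n. c_term j)\<bar> \<le> 4 * (1/2) ^ n"
proof -
  have sm: "summable (\<lambda>j. 2 * (1/2::real) ^ (j + n))"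
    by (intro summable_mult summable_ignore_initial_segment summable_geometric) simp
  have bd: "norm (c_term (j + n)) \<le> 2 * (1/2) ^ (j + n)" for j
    using abs_c_term_le[of "j + n"] by simp
  have "c_const - (\<Sum>j<n. c_term j) = (\<Sum>j. c_term (j + n))"
    unfolding c_const_def using suminf_split_initial_segment[OF summable_c_term, of n] by simp
  also have "\<bar>\<dots>\<bar> \<le> (\<Sum>j. 2 * (1/2) ^ (j + n))"
    using norm_suminf_le[OF bd sm] by simp
  also have "\<dots> = (\<Sum>j. (2 * (1/2) ^ n) * (1/2) ^ j)" by (simp add: power_add mult_ac)
  also have "\<dots> = (2 * (1/2) ^ n) * (\<Sum>j. (1/2) ^ j)"
    by (rule suminf_mult) (simp add: summable_geometric)
  also have "\<dots> = 4 * (1/2) ^ n" by (simp add: suminf_geometric)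
  finally show ?thesis .
qed

text \<open>A lower approximation of \<open>c_partial\<close> in units of \<open>10\<^sup>-\<^sup>1\<^sup>5\<close>: each step of the
  recursion is rounded down, and since \<open>c_factor n < 1\<close> the rounding errors at most add up.\<close>
primrec c_lower :: "nat \<Rightarrow> int" where
  "c_lower 0 = 0"
| "c_lower (Suc n) = (c_lower n * (2 ^ (n + 1) - 1) + 2 ^ (n + 1) * 10 ^ 15) * (2 ^ (n + 2) - 3)
    div ((2 ^ (n + 1) - 1) * (2 ^ (n + 2) - 1))"

lemma c_partial_bounds:
  "of_int (c_lower n) / 10 ^ 15 \<le> c_partial n \<and> c_partial n \<le> of_int (c_lower n + int n) / 10 ^ 15"
proof (induction n)
  case (Suc n)
  define u where "u = (2::real) ^ n"
  have u: "u \<ge> 1" by (simp add: u_def)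
  define x where "x = of_int (c_lower n) / (10 ^ 15 :: real)"
  let ?num = "(c_lower n * (2 ^ (n + 1) - 1) + 2 ^ (n + 1) * 10 ^ 15) * (2 ^ (n + 2) - 3)"
  let ?den = "(2 ^ (n + 1) - 1) * (2 ^ (n + 2) - 1) :: int"
  define y where "y = c_factor n * (x + (1 + 1 / (2 ^ (n + 1) - 1)))"
  have num: "of_int ?num = (of_int (c_lower n) * (2 * u - 1) + 2 * u * 10 ^ 15) * (4 * u - 3)"
    and den: "of_int ?den = (2 * u - 1) * (4 * u - 1)"
    by (simp_all add: u_def)
  have cf: "c_factor n = (4 * u - 3) / (4 * u - 1)"
    using u by (simp add: c_factor_def u_def[symmetric] divide_simps)
  have w: "1 + 1 / (2 ^ (n + 1) - 1) = 2 * u / (2 * u - 1)"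
    using u by (simp add: u_def[symmetric] divide_simps)
  have y: "y = of_int ?num / of_int ?den / 10 ^ 15"
  proof -
    have "a / b * (l / S + c / d) = (l * d + c * S) * a / (d * b) / S"
      if "d \<noteq> 0" "S \<noteq> 0" for a b c d l S :: real
      using that by (simp add: add_frac_eq mult_ac)
    from this[of "2 * u - 1" "10 ^ 15"] show ?thesis unfolding y_def cf w num den x_def using u by simp
  qed
  have "c_lower (Suc n) = \<lfloor>of_int ?num / (of_int ?den :: real)\<rfloor>"
    by (simp only: c_lower.simps floor_divide_of_int_eq)
  then have "of_int (c_lower (Suc n)) \<le> of_int ?num / (of_int ?den :: real)"
      "of_int ?num / (of_int ?den :: real) \<le> of_int (c_lower (Suc n)) + 1"
    by linarith+
  then have fl: "of_int (c_lower (Suc n)) / 10 ^ 15 \<le> y" "y \<le> (of_int (c_lower (Suc n)) + 1) / 10 ^ 15"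
    unfolding y by (auto intro!: divide_right_mono simp del: c_lower.simps of_int_mult of_int_add of_int_diff of_int_power)
  have "y \<le> c_partial (Suc n)"
    unfolding c_partial_Suc y_def using Suc c_factor_bounds(1)[of n] by (intro mult_left_mono) (auto simp: x_def)
  moreover have "c_partial (Suc n) - y = c_factor n * (c_partial n - x)"
    unfolding c_partial_Suc y_def by (simp add: algebra_simps)
  moreover have "c_factor n * (c_partial n - x) \<le> 1 * (c_partial n - x)"
    using Suc c_factor_bounds[of n] by (intro mult_right_mono) (auto simp: x_def)
  moreover have "c_partial n - x \<le> real n / 10 ^ 15"
    using Suc by (simp add: x_def add_divide_distrib)
  ultimately have up: "c_partial (Suc n) \<le> y + real n / 10 ^ 15" and "y \<le> c_partial (Suc n)"
    by (simp_all only: mult_1)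
  note up
  also have "y + real n / 10 ^ 15 \<le> (of_int (c_lower (Suc n)) + 1) / 10 ^ 15 + real n / 10 ^ 15"
    using fl(2) by (rule add_right_mono)
  also have "\<dots> = of_int (c_lower (Suc n) + int (Suc n)) / (10 ^ 15 :: real)"
    by (simp only: of_int_add of_int_of_nat_eq of_nat_Suc add_divide_distrib add_ac)
  finally show ?case using order_trans[OF fl(1) \<open>y \<le> c_partial (Suc n)\<close>] by (rule conjI[rotated])
qed (simp add: c_partial_def)

text \<open>The tolerance is half a unit of the last decimal. At n = 48 the tail of the series costs
  4/2^48, setting the tail product to 1 costs less than 47/2^47, and the rounding costs
  48/10^15.\<close>

lemma c_const_approx: "\<bar>c_const - (- 1.17094960687)\<bar> \<le> 5 / 10 ^ 12"
proof -
  have lo: "c_lower 48 = 46829050393129103" by code_simp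
  let ?R = "\<Prod>i. c_factor (i + 48)"
  have D: "46829050393129103 / 1000000000000000 \<le> c_partial 48"
      "c_partial 48 \<le> 46829050393129151 / 1000000000000000"
    using c_partial_bounds[of 48] unfolding lo by simp_all
  have h: "(1/2::real) ^ 48 = 1 / 281474976710656" by (simp add: power_one_over)
  define z where "z = ?R * c_partial 48"
  have "(1 - 2 * (1/2) ^ 48) * c_partial 48 \<le> z"
    unfolding z_def using D(1) by (intro mult_right_mono[OF prodinf_c_factor_bounds(1)]) linarith
  moreover have "z \<le> 1 * c_partial 48"
    unfolding z_def using D(1) by (intro mult_right_mono[OF prodinf_c_factor_bounds(2)]) linarith
  moreover have "\<bar>c_const - (z - 48)\<bar> \<le> 4 * (1/2) ^ 48"
    using c_const_tail[of 48] unfolding sum_c_term z_def by simp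
  moreover have "(1 - 2 * (1 / 281474976710656)) * c_partial 48
      = c_partial 48 - c_partial 48 / 140737488355328"
    by (simp add: left_diff_distrib)
  ultimately have "\<bar>c_const + 117094960687 / 100000000000\<bar> \<le> 5 / 1000000000000"
    using D unfolding h by linarith
  then show ?thesis by simp
qed

section \<open>The sequence of exponents\<close>

text \<open>The exponents produced by the optimal choice of \<open>lam\<close> in every step, starting from \<open>c 0 = 1\<close>,
  are \<open>c k = (k + 2) / (2^(k+1) - 1) - 1\<close>, with limit \<open>-1\<close>. To reach the limit \<open>c_const\<close>, one step
  uses a smaller \<open>lam\<close>, which lowers all later exponents by \<open>d\<close>.\<close>
definition c_seq :: "real \<Rightarrow> nat \<Rightarrow> real" where
  "c_seq d k = (real k + 2) / (2 ^ (k + 1) - 1) - 1 - (if k < 2 then 0 else d)"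

lemma c_seq_0 [simp]: "c_seq d 0 = 1" and c_seq_1 [simp]: "c_seq d (Suc 0) = 0"
  by (simp_all add: c_seq_def)

text \<open>The condition \<open>lam \<le> 1 - 2 * \<beta>'\<close> expressed through the sequence.
  For d = 0 it is an equality, the recurrence of the optimal choice. A constant decrease cancels in
  the difference and raises the right side, and the step at which it starts lowers the left
  side.\<close>

lemma c_seq_Suc_le:
  assumes "0 \<le> d"
  shows "(c_seq d (Suc k) - c_seq d k) * (2 ^ (k + 2) - 1) \<le> - (c_seq d k + real k + 2)"
proof -
  define w where "w = (2::real) ^ (k + 1)"
  have w: "w \<ge> 2" by (simp add: w_def)
  define t where "t k = (if k < 2 then 0 else d)" for k :: nat
  have t: "0 \<le> t k" "t k \<le> t (Suc k)" using assms by (auto simp: t_def)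
  have eq: "((real k + 3) / (2 * w - 1) - (real k + 2) / (w - 1)) * (2 * w - 1)
      = - ((real k + 2) / (w - 1) - 1 + real k + 2)"
    using w by (simp add: divide_simps) (simp add: algebra_simps)
  have "(c_seq d (Suc k) - c_seq d k) * (2 ^ (k + 2) - 1)
      = ((real k + 3) / (2 * w - 1) - (real k + 2) / (w - 1) - (t (Suc k) - t k)) * (2 * w - 1)"
    by (simp add: c_seq_def t_def w_def)
  also have "\<dots> = - ((real k + 2) / (w - 1) - 1 + real k + 2) - (t (Suc k) - t k) * (2 * w - 1)"
    using eq by (simp add: left_diff_distrib)
  also have "\<dots> \<le> - ((real k + 2) / (w - 1) - 1 + real k + 2) + t k"
  proof -
    have "0 \<le> (t (Suc k) - t k) * (2 * w - 1)" using t w by (intro mult_nonneg_nonneg) simp_all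
    then show ?thesis using t(1) by linarith
  qed
  also have "\<dots> = - (c_seq d k + real k + 2)" by (simp add: c_seq_def t_def w_def)
  finally show ?thesis .
qed

text \<open>The conditions \<gamma> \<ge> 0 and \<open>lam \<ge> 0\<close>. The first is an equality
  at k = 0 and k = 1, so the decrease cannot start before k = 2; there it reads d \<le> 4/7, which d
  \<le> 1/2 ensures.\<close>

lemma c_seq_ge:
  assumes d: "0 \<le> d" "d \<le> 1/2"
  shows "0 \<le> real k - 1 + c_seq d k" "c_seq d k - 1 \<le> c_seq d (Suc k)"
proof -
  define e where "e i = (real i + 2) / (2 ^ (i + 1) - 1)" for i :: nat
  have e0: "0 \<le> e i" for i
  proof -
    have "(1::real) \<le> 2 ^ (i + 1)" by (rule one_le_power) simp
    then show ?thesis unfolding e_def by (intro divide_nonneg_nonneg) simp_all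
  qed
  consider "k = 0" | "k = 1" | "k \<ge> 2" by linarith
  then have "0 \<le> real k - 1 + c_seq d k \<and> c_seq d k - 1 \<le> c_seq d (Suc k)"
  proof cases
    case 3
    then obtain j where j: "k = j + 2" by (metis add.commute le_Suc_ex)
    have "real j + 5 \<le> 8 * 2 ^ j" by (induction j) simp_all
    then have "e k \<le> 1" unfolding e_def j by (subst divide_le_eq_1_pos) (simp_all add: power_add)
    moreover have "c_seq d k = e k - 1 - d" "c_seq d (Suc k) = e (Suc k) - 1 - d"
      using 3 by (simp_all add: c_seq_def e_def)
    moreover have "0 \<le> real k - 2 + e k - d"
    proof (cases "j = 0")
      case True
      then show ?thesis using d j by (simp add: e_def)
    next
      case False
      then have "3 \<le> real k" using j by simp
      then show ?thesis using d e0[of k] by linarith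
    qed
    ultimately show ?thesis using e0[of "Suc k"] by linarith
  qed (use d in \<open>auto simp: c_seq_def\<close>)
  then show "0 \<le> real k - 1 + c_seq d k" "c_seq d k - 1 \<le> c_seq d (Suc k)" by blast+
qed

text \<open>The condition \<beta> \<le> 1, under which the bounds for the shortened correlations
  increase with their length. It is an equality at k = 0.\<close>

lemma c_seq_le: "0 \<le> d \<Longrightarrow> real k + 3 + c_seq d k \<le> 2 ^ (k + 2)"
proof -
  assume d: "0 \<le> d"
  have "(real k + 2) / (2 ^ (k + 1) - 1) \<le> 2 * 2 ^ (k + 1) - (real k + 2)"
  proof -
    define u where "u = (2::real) ^ (k + 1)"
    have "real k + 2 \<le> 2 * (u - 1)" "u \<ge> 2"
      unfolding u_def by (induction k) simp_all
    then have "(real k + 2) * u \<le> 2 * (u - 1) * u" by (intro mult_right_mono) auto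
    then have "real k + 2 \<le> (2 * u - (real k + 2)) * (u - 1)" by (simp add: algebra_simps)
    then show ?thesis using \<open>u \<ge> 2\<close> unfolding u_def[symmetric] by (simp add: pos_divide_le_eq)
  qed
  then show ?thesis using d by (auto simp: c_seq_def)
qed

lemma exp_sum_bound_c_seq:
  assumes P: "finite P" "\<forall>p\<in>P. prime p" and b: "b > 1" and d: "0 \<le> d" "d \<le> 1/2"
    and A: "A \<ge> 6 * real (\<Prod>P)" "A \<ge> 3"
    and B: "B \<ge> 4 * (sqrt (real b ^ period_exp P) * (\<Prod>p\<in>P. sqrt (real p) / (sqrt (real p) - 1)))"
      "B \<ge> 1" "B \<ge> real b ^ period_exp P"
  shows "exp_sum_bound P b A B (1 / (2 ^ (k + 2) - 2)) ((real k + 3 + c_seq d k) / 2 ^ (k + 2))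
    ((real k - 1 + c_seq d k) / 2 ^ (k + 2)) (1 / 2 ^ k)"
proof (induction k)
  case 0
  show ?case using exp_sum_bound_0[OF P b A(2) B(3)] by simp
next
  case (Suc k)
  define v where "v = (2::real) ^ (k + 2)"
  have v: "v \<ge> 4" "2 ^ (k + 3) = 2 * v" by (simp_all add: v_def power_add)
  define \<alpha> where "\<alpha> = 1 / (v - 2)"
  \<comment> \<open>Solves the recursions for \<beta> and for \<gamma> at once: both exponents
    contain \<open>c k\<close> with the same coefficient and grow by 1 in the numerator from
    \<open>k\<close> to \<open>k + 1\<close>.\<close>
  define lam where "lam = (1 + c_seq d (Suc k) - c_seq d k) / (v * \<alpha>)"
  have \<alpha>: "0 < \<alpha>" "\<alpha> \<le> 1/2" using v by (simp_all add: \<alpha>_def divide_simps)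
  have \<alpha>lam: "\<alpha> * lam = (1 + c_seq d (Suc k) - c_seq d k) / v"
    using \<alpha> by (simp add: lam_def)
  have lam: "0 \<le> lam" using c_seq_ge(2)[OF d, of k] v \<alpha> by (simp add: lam_def)
  have ub: "lam \<le> 1 - 2 * ((real (Suc k) + 3 + c_seq d (Suc k)) / (2 * v))"
  proof -
    have "(c_seq d (Suc k) - c_seq d k) * (v - 1) \<le> - (c_seq d k + real k + 2)"
      using c_seq_Suc_le[OF d(1)] unfolding v_def .
    then have "(1 + c_seq d (Suc k) - c_seq d k) * (v - 2) \<le> v - (real k + 4 + c_seq d (Suc k))"
      by (simp add: algebra_simps)
    moreover have "lam = (1 + c_seq d (Suc k) - c_seq d k) * (v - 2) / v"
      by (simp add: lam_def \<alpha>_def)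
    moreover have "1 - 2 * ((real (Suc k) + 3 + c_seq d (Suc k)) / (2 * v))
        = (v - (real k + 4 + c_seq d (Suc k))) / v"
      using v by (simp add: field_simps)
    ultimately show ?thesis using v by (simp add: divide_right_mono)
  qed
  have "exp_sum_bound P b A B (1 / (2 * v - 2)) ((real (Suc k) + 3 + c_seq d (Suc k)) / (2 * v))
    ((real (Suc k) - 1 + c_seq d (Suc k)) / (2 * v)) (1 / 2 ^ k / 2)"
  proof (rule exp_sum_bound_step[OF P b Suc.IH[folded v_def] _ _ _ _ _ lam ub _ _ _ A(1) B(1,2)])
    show "0 < 1 / (v - 2)" "1 / (v - 2) \<le> 1/2" using \<alpha> by (simp_all add: \<alpha>_def)
    show "(real k + 3 + c_seq d k) / v \<le> 1" using c_seq_le[OF d(1), of k] v by (simp add: v_def)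
    show "0 \<le> (real k - 1 + c_seq d k) / v" using c_seq_ge(1)[OF d, of k] v by simp
    show "1 / (2 * v - 2) = 1 / (v - 2) / (2 * (1 + 1 / (v - 2)))" using v by (simp add: field_simps)
    show "(real (Suc k) + 3 + c_seq d (Suc k)) / (2 * v) = ((real k + 3 + c_seq d k) / v + 1 / (v - 2) * lam) / 2"
      unfolding \<alpha>lam[unfolded \<alpha>_def] using v by (simp add: field_simps)
    show "(real (Suc k) - 1 + c_seq d (Suc k)) / (2 * v) = ((real k - 1 + c_seq d k) / v + 1 / (v - 2) * lam) / 2"
      unfolding \<alpha>lam[unfolded \<alpha>_def] using v by (simp add: field_simps)
  qed simp
  then show ?case by (simp add: v_def mult.commute)
qed

section \<open>Comparison with the constants of the theorem, and conclusion\<close>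

lemma one_le_prod_primes:
  assumes "\<forall>p\<in>P. prime (p :: nat)"
  shows "1 \<le> real (\<Prod>P)"
proof -
  have "1 \<le> (\<Prod>p\<in>P. p)" using assms by (intro prod_ge_1) (metis prime_ge_1_nat)
  then show ?thesis by (simp del: of_nat_prod)
qed

text \<open>Of \<open>K1\<close> only 6 Q^(3/2) \<ge> 6 Q is kept, with Q = \<open>\<Prod>P\<close>;
  all other factors are at least 1.\<close>

lemma K1_ge:
  assumes P: "finite P" "\<forall>p\<in>P. prime p" and b: "b \<ge> 2"
  shows "6 * real (\<Prod>P) \<le> K1 P b"
proof -
  have Q1: "1 \<le> real (\<Prod>P)" by (rule one_le_prod_primes[OF P(2)])
  have "1 \<le> (\<Prod>p\<in>P. real p powr (1/2) / ((real p powr (1/2) - 1) * (1 - 1 / real p)))"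
  proof (rule prod_ge_1)
    fix p assume "p \<in> P"
    then have "real p > 1" using P prime_gt_1_nat[of p] by simp
    then have s: "sqrt (real p) - 1 > 0" "0 < 1 - 1 / real p" "1 - 1 / real p < 1" by simp_all
    then have "(sqrt (real p) - 1) * (1 - 1 / real p) \<le> (sqrt (real p) - 1) * 1"
      by (intro mult_left_mono) auto
    also have "\<dots> \<le> sqrt (real p)" by simp
    finally show "1 \<le> real p powr (1/2) / ((real p powr (1/2) - 1) * (1 - 1 / real p))"
      using s by (simp add: powr_half_sqrt)
  qed
  moreover have "1 \<le> 2 powr (real (card P) + 7/2)" by (rule ge_one_powr_ge_zero) auto
  moreover have "real (\<Prod>P) \<le> real (\<Prod>P) powr (3/2)"
    using powr_mono[of 1 "3/2" "real (\<Prod>P)"] Q1 by simp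
  moreover have "1 \<le> (of_int b :: real) ^ (4 * \<Prod>P)" using b by (intro one_le_power) simp
  ultimately have "6 * 1 * real (\<Prod>P) * 1 * 1 \<le> K1 P b"
    unfolding K1_def using Q1 by (intro mult_mono) (auto intro: mult_nonneg_nonneg)
  then show ?thesis by simp
qed

lemma prod_sqrt_ge_1:
  assumes "\<forall>p\<in>P. prime p"
  shows "1 \<le> (\<Prod>p\<in>P. sqrt (real p) / (sqrt (real p) - 1))"
proof (rule prod_ge_1)
  fix p assume "p \<in> P"
  then have "real p > 1" using assms prime_gt_1_nat[of p] by simp
  then show "1 \<le> sqrt (real p) / (sqrt (real p) - 1)" by simp
qed

text \<open>One factor 2 comes from 2^(3/2), the other from b^(2Q) = b^Q b^Q \<ge> 2 b^Q, where Q =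
  \<open>\<Prod>P\<close> \<ge> \<tau>. Having b^\<tau> instead of its root makes this cover all
  lower bounds on \<open>B\<close>.\<close>

lemma K3_ge:
  assumes P: "finite P" "\<forall>p\<in>P. prime p" and b: "b > 1"
  defines "prd \<equiv> \<Prod>p\<in>P. sqrt (real p) / (sqrt (real p) - 1)"
  shows "4 * (real b ^ period_exp P * prd) \<le> K3 P (int b)"
proof -
  have Q1: "1 \<le> \<Prod>P" using one_le_prod_primes[OF P(2)] by (simp only: real_of_nat_ge_one_iff One_nat_def)
  have prd: "1 \<le> prd" unfolding prd_def by (rule prod_sqrt_ge_1[OF P(2)])
  have "real b ^ period_exp P \<le> real b ^ \<Prod>P" using b period_exp_le[of P] by (intro power_increasing) auto
  moreover have "2 ^ 1 \<le> real b ^ \<Prod>P"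
    using b Q1 order_trans[OF power_mono[of 2 "real b" 1] power_increasing[OF Q1, of "real b"]] by simp
  ultimately have "2 * real b ^ period_exp P \<le> real b ^ \<Prod>P * real b ^ \<Prod>P"
    by (intro mult_mono) auto
  also have "\<dots> = real b ^ (2 * \<Prod>P)" by (simp add: mult_2 power_add)
  finally have "2 * real b ^ period_exp P \<le> real b ^ (2 * \<Prod>P)" .
  moreover have "2 \<le> (2::real) powr (3/2)" using powr_mono[of 1 "3/2" "2::real"] by simp
  moreover have "1 \<le> real (\<Prod>P) powr (1/2)" using Q1 by (intro ge_one_powr_ge_zero) (auto simp del: of_nat_prod)
  ultimately have "2 * 1 * (2 * real b ^ period_exp P) * prd
      \<le> 2 powr (3/2) * real (\<Prod>P) powr (1/2) * real b ^ (2 * \<Prod>P) * prd"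
    using prd by (intro mult_mono) auto
  also have "\<dots> = K3 P (int b)" by (simp add: K3_def prd_def powr_half_sqrt)
  finally show ?thesis by simp
qed

lemma e2pi_of_real: "e2pi (of_real x) = unit_exp x"
  by (simp add: e2pi_def unit_exp_def cis_conv_exp mult_ac)

lemma sum_e2pi_eq_exp_sum:
  "(\<Sum>n = 1..N. e2pi (of_int a / of_nat m * of_int (int b) ^ n)) = exp_sum b m (a * int b) N"
proof -
  have "e2pi (of_int a / of_nat m * of_int (int b) ^ Suc n) = unit_exp (of_int (a * int b * int b ^ n) / real m)" for n
  proof -
    have "(of_int a / of_nat m * of_int (int b) ^ Suc n :: complex) = of_real (of_int (a * int b * int b ^ n) / real m)"
      by simp
    then show ?thesis by (simp only: e2pi_of_real)
  qed
  moreover have "(\<Sum>n = 1..N. F n) = (\<Sum>n<N. F (Suc n))" for F :: "nat \<Rightarrow> complex"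
    by (intro sum.reindex_bij_witness[of _ Suc "\<lambda>n. n - 1"]) auto
  ultimately show ?thesis by (simp add: exp_sum_def)
qed

text \<open>Where the numerical value enters the bound for the sums: the target lies below the
  optimal limit -1, and close enough to it to be admissible.\<close>

lemma c_const_between: "0 \<le> - 1 - c_const" "- 1 - c_const \<le> 1/2"
proof -
  have "\<bar>c_const + 117094960687 / 100000000000\<bar> \<le> 5 / 1000000000000"
    using c_const_approx by simp
  then show "0 \<le> - 1 - c_const" "- 1 - c_const \<le> 1/2" by linarith+
qed

theorem theorem1p1:
  shows "\<bar>c_const - (- 1.17094960687)\<bar> \<le> 5 / 10 ^ 12 \<and>
    (\<exists>c :: nat \<Rightarrow> real.
      (\<forall>k. \<bar>c k - c_const\<bar> \<le> (real k + 7) / 2 powr (real k - 1)) \<and>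
      (\<forall>(P :: nat set) (m :: nat) (a :: int) (b :: int) (k :: nat) (N :: nat).
         finite P \<longrightarrow> (\<forall>p\<in>P. prime p) \<longrightarrow> m \<in> nats_over P \<longrightarrow>
         gcd a (int m) = 1 \<longrightarrow> b \<ge> 2 \<longrightarrow> gcd (int m) b = 1 \<longrightarrow> N \<ge> 1 \<longrightarrow>
         norm (\<Sum>n = 1..N. e2pi (of_int a / of_nat m * of_int b ^ n))
           \<le> K1 P b * K2 P ^ k * real m powr (1 / (2 ^ (k + 2) - 2))
                 * real N powr (1 - (real k + 3 + c k) / 2 ^ (k + 2))
                 * (1 + ln (real m)) powr (1 / 2 ^ k)
             + K3 P b * real m powr (- 1 / (2 ^ (k + 2) - 2))
                 * real N powr (1 + (real k - 1 + c k) / 2 ^ (k + 2))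
                 * (1 + ln (real m)) powr (1 / 2 ^ k)))"
\<comment> \<open>\<open>c_seq d\<close> tends to \<open>- 1 - d\<close>, so this \<open>d\<close>
  makes \<open>c_const\<close> the limit.\<close>
proof (intro conjI exI[of _ "c_seq (- 1 - c_const)"] allI impI)
  show c: "\<bar>c_const - (- 1.17094960687)\<bar> \<le> 5 / 10 ^ 12" by (rule c_const_approx)
  define d where "d = - 1 - c_const"
  have d: "0 \<le> d" "d \<le> 1/2" unfolding d_def by (rule c_const_between)+
  show "\<bar>c_seq (- 1 - c_const) k - c_const\<bar> \<le> (real k + 7) / 2 powr (real k - 1)" for k
    unfolding d_def[symmetric]
  proof (cases "k < 2")
    case True
    then consider "k = 0" | "k = 1" by linarith
    then show "\<bar>c_seq d k - c_const\<bar> \<le> (real k + 7) / 2 powr (real k - 1)"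
      using c_const_between by cases (simp_all add: powr_minus abs_le_iff)
  next
    case False
    then have eq: "c_seq d k - c_const = (real k + 2) / (2 ^ (k + 1) - 1)"
      by (simp add: c_seq_def d_def)
    have u: "0 \<le> (2::real) ^ (k + 1) - 1" "2 ^ k / 2 \<le> (2::real) ^ (k + 1) - 1"
      using one_le_power[of "2::real" k] unfolding power_add power_one_right by linarith+
    have "(real k + 2) / (2 ^ (k + 1) - 1) \<le> (real k + 7) / (2 ^ k / 2)"
      by (rule frac_le[OF _ _ _ u(2)]) simp_all
    moreover have "0 \<le> (real k + 2) / (2 ^ (k + 1) - 1)"
      using u(1) by (intro divide_nonneg_nonneg) simp_all
    moreover have "2 powr (real k - 1) = (2::real) ^ k / 2" by (simp add: powr_diff powr_realpow)
    ultimately show "\<bar>c_seq d k - c_const\<bar> \<le> (real k + 7) / 2 powr (real k - 1)"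
      unfolding eq by (simp only: abs_of_nonneg)
  qed
next
  fix P :: "nat set" and m :: nat and a b :: int and k N :: nat
  assume P: "finite P" "\<forall>p\<in>P. prime p" and m: "m \<in> nats_over P" and am: "gcd a (int m) = 1"
    and b: "b \<ge> 2" and mb: "gcd (int m) b = 1" and N: "N \<ge> 1"
  define c where "c = c_seq (- 1 - c_const)"
  have d: "0 \<le> - 1 - c_const" "- 1 - c_const \<le> 1/2" by (rule c_const_between)+
  define b' where "b' = nat b"
  have b': "b = int b'" "b' > 1" using b by (simp_all add: b'_def)
  have cop: "coprime m b'" using mb unfolding b'(1) coprime_iff_gcd_eq_1[symmetric] coprime_int_iff .
  have "coprime a (int m)" using am unfolding coprime_iff_gcd_eq_1 .
  moreover have "coprime (int b') (int m)" using cop by (simp add: coprime_commute)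
  ultimately have cop': "coprime (a * int b') (int m)" by simp
  define prd where "prd = (\<Prod>p\<in>P. sqrt (real p) / (sqrt (real p) - 1))"
  have prd: "1 \<le> prd" unfolding prd_def by (rule prod_sqrt_ge_1[OF P(2)])
  define x where "x = real b' ^ period_exp P"
  have x: "1 \<le> x" unfolding x_def using b'(2) by (intro one_le_power) simp
  have Q1: "1 \<le> real (\<Prod>P)" by (rule one_le_prod_primes[OF P(2)])
  have A: "6 * real (\<Prod>P) \<le> K1 P b" by (rule K1_ge[OF P b])
  have B: "4 * (x * prd) \<le> K3 P b" using K3_ge[OF P b'(2)] by (simp add: b'(1) x_def prd_def)
  have "sqrt x \<le> x" using x real_sqrt_le_mono[of x "x * x"] mult_left_mono[of 1 x x] by simp
  then have "sqrt x * prd \<le> x * prd" using prd by (intro mult_right_mono) auto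
  then have B1: "4 * (sqrt x * prd) \<le> K3 P b" using B by linarith
  have "x * 1 \<le> x * prd" using x prd by (intro mult_left_mono) auto
  then have B2: "1 \<le> K3 P b" "x \<le> K3 P b" using B x by linarith+
  let ?L = "(1 + ln (real m)) powr (1 / 2 ^ k)"
  let ?F = "real m powr (1 / (2 ^ (k + 2) - 2)) * real N powr (1 - (real k + 3 + c k) / 2 ^ (k + 2))"
  have K2: "1 \<le> K2 P ^ k" unfolding K2_def by (intro one_le_power) simp
  have A3: "3 \<le> K1 P b" using A Q1 by linarith
  have "norm (\<Sum>n = 1..N. e2pi (of_int a / of_nat m * of_int b ^ n)) = norm (exp_sum b' m (a * int b') N)"
    unfolding b'(1) sum_e2pi_eq_exp_sum ..
  also have "\<dots> \<le> (K1 P b * real m powr (1 / (2 ^ (k + 2) - 2)) * real N powr (1 - (real k + 3 + c k) / 2 ^ (k + 2))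
      + K3 P b * real m powr (- (1 / (2 ^ (k + 2) - 2))) * real N powr (1 + (real k - 1 + c k) / 2 ^ (k + 2))) * ?L"
    using exp_sum_bound_c_seq[OF P b'(2) d A A3 B1[unfolded x_def prd_def] B2(1) B2(2)[unfolded x_def], of k]
      m cop cop' N unfolding exp_sum_bound_def c_def by blast
  also have "\<dots> = K1 P b * 1 * ?F * ?L
      + K3 P b * real m powr (- 1 / (2 ^ (k + 2) - 2)) * real N powr (1 + (real k - 1 + c k) / 2 ^ (k + 2)) * ?L"
    by (simp add: distrib_right mult.assoc)
  \<comment> \<open>The constants obtained are independent of \<open>k\<close>, so
    \<open>K2 P ^ k\<close> is inserted merely as a factor at least 1.\<close>
  also have "K1 P b * 1 * ?F * ?L \<le> K1 P b * K2 P ^ k * ?F * ?L"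
    using K2 A3 by (intro mult_right_mono mult_left_mono) auto
  finally show "norm (\<Sum>n = 1..N. e2pi (of_int a / of_nat m * of_int b ^ n))
      \<le> K1 P b * K2 P ^ k * real m powr (1 / (2 ^ (k + 2) - 2))
            * real N powr (1 - (real k + 3 + c_seq (- 1 - c_const) k) / 2 ^ (k + 2)) * ?L
        + K3 P b * real m powr (- 1 / (2 ^ (k + 2) - 2))
            * real N powr (1 + (real k - 1 + c_seq (- 1 - c_const) k) / 2 ^ (k + 2)) * ?L"
    unfolding c_def[symmetric] by (simp only: mult.assoc)
qed

end
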